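(* Let $P$ be a convex polygon in the plane, let $k\ge 1$, and let $\lambda_1,\dots,\lambda_k>0$ satisfy $\prod_{i=1}^k\lambda_i=1$. Let $T$ be the refractive outer billiard map about $P$ with refractive indices $\lambda_1,\dots,\lambda_k$. If $P$ is rational and each of $\lambda_1,\dots,\lambda_k$ is a rational number, then every orbit of $T$ is periodic; that is, for every strongly regular point $o$ the orbit $(T^m(o))_{m\in\mathbb{Z}}$ is periodic.
   Context: Refractive outer billiards. $P$ is a (nondegenerate) convex polygon; the indices of $\lambda_i$ are read modulo $k$ (so $\lambda_0=\lambda_k$). For a point $B$ and $\lambda>0$ let $\rho_{B,\lambda}(z)=B+\lambda(B-z)$ (reflection about $B$ followed by scaling by $\lambda$ about $B$). For a point $z$ outside $P$ and not on any line through a side of $P$, there are two supporting rays from $z$ to $P$: $L_+(z)$, with $P$ lying to its right, and $L_-(z)$, with $P$ lying to its left; each touches $P$ at a single vertex. The contact vertex of $L_+(z)$ is the head of $P$ about $z$, that of $L_-(z)$ is the tail of $P$ about $z$. Starting from a point $o=T^0(o)$ outside $P$: for $m\ge 1$, $T^m(o)=\rho_{A_m,\lambda_m}(T^{m-1}(o))$, where $A_m$ is the head of $P$ about $T^{m-1}(o)$; for $m\le 0$, $T^{m-1}(o)=\rho_{A_m,1/\lambda_m}(T^m(o))$, where $A_m$ is the tail of $P$ about $T^m(o)$. A step is undefined when the current point lies on a line through a side of $P$. The point $o$ is strongly regular if $T^m(o)$ is defined for all $m\in\mathbb{Z}$ and none of these points lies on a line through a side of $P$. Orbits are considered for strongly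 regular points only. Periodicity. The orbit of $o$ is periodic if there exists an integer $N>0$ such that $T^{m+N}(o)=T^m(o)$ and $\lambda_{m+N}=\lambda_m$ for all $m\in\mathbb{Z}$. Rationality. $P$ is rational if its vertices belong to a lattice, i.e. there are a point $c$ and linearly independent vectors $e_1,e_2$ in the plane such that every vertex of $P$ lies in $c+\mathbb{Z}e_1+\mathbb{Z}e_2$ (the choice of origin $c$ being immaterial). *)

theory Defs
  imports "HOL-Analysis.Analysis"
begin

definition convex_polygon :: "(real^2) set \<Rightarrow> bool" where
  "convex_polygon P \<longleftrightarrow> polytope P \<and> interior P \<noteq> {}"

definition rational_polygon :: "(real^2) set \<Rightarrow> bool" where
  "rational_polygon P \<longleftrightarrow>
     (\<exists>c e1 e2. e1 \<noteq> e2 \<and> independent {e1, e2} \<and>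
        (\<forall>v. v extreme_point_of P \<longrightarrow>
           (\<exists>a b :: int. v = c + of_int a *\<^sub>R e1 + of_int b *\<^sub>R e2)))"

definition on_side_line :: "(real^2) set \<Rightarrow> real^2 \<Rightarrow> bool" where
  "on_side_line P z \<longleftrightarrow> (\<exists>s. s edge_of P \<and> z \<in> affine hull s)"

text \<open>The orientation determinant of the pair \<open>(u, v)\<close>: it is negative iff \<open>v\<close> points
  to the right of \<open>u\<close>, positive iff \<open>v\<close> points to the left of \<open>u\<close>.\<close>

definition cross2 :: "real^2 \<Rightarrow> real^2 \<Rightarrow> real" where
  "cross2 u v = u$1 * v$2 - u$2 * v$1"

definition ray :: "real^2 \<Rightarrow> real^2 \<Rightarrow> (real^2) set" where
  "ray z d = {z + t *\<^sub>R d | t. t \<ge> 0}"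

definition right_supporting :: "(real^2) set \<Rightarrow> real^2 \<Rightarrow> real^2 \<Rightarrow> bool" where
  "right_supporting P z d \<longleftrightarrow>
     d \<noteq> 0 \<and> ray z d \<inter> P \<noteq> {} \<and> (\<forall>p\<in>P. cross2 d (p - z) \<le> 0)"

definition left_supporting :: "(real^2) set \<Rightarrow> real^2 \<Rightarrow> real^2 \<Rightarrow> bool" where
  "left_supporting P z d \<longleftrightarrow>
     d \<noteq> 0 \<and> ray z d \<inter> P \<noteq> {} \<and> (\<forall>p\<in>P. cross2 d (p - z) \<ge> 0)"

text \<open>\<open>head P z\<close> and \<open>tail P z\<close> are meaningful only for \<open>z\<close> outside the polygon \<open>P\<close> and
  not on a line through a side; then the supporting ray and its contact vertex are unique.\<close>

definition head :: "(real^2) set \<Rightarrow> real^2 \<Rightarrow> real^2" where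
  "head P z = (THE A. A extreme_point_of P \<and> (\<exists>d. right_supporting P z d \<and> A \<in> ray z d))"

definition tail :: "(real^2) set \<Rightarrow> real^2 \<Rightarrow> real^2" where
  "tail P z = (THE A. A extreme_point_of P \<and> (\<exists>d. left_supporting P z d \<and> A \<in> ray z d))"

definition refl_scale :: "real^2 \<Rightarrow> real \<Rightarrow> real^2 \<Rightarrow> real^2" where
  "refl_scale B l z = B + l *\<^sub>R (B - z)"

text \<open>The indices \<open>l 1, \<dots>, l k\<close> extended \<open>k\<close>-periodically to all integers; values of \<open>l\<close>
  outside \<open>{1..k}\<close> are never used.\<close>

definition refr_index :: "nat \<Rightarrow> (nat \<Rightarrow> real) \<Rightarrow> int \<Rightarrow> real" where
  "refr_index k l m = l (Suc (nat ((m - 1) mod int k)))"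

definition forward_step :: "(real^2) set \<Rightarrow> real \<Rightarrow> real^2 \<Rightarrow> (real^2) option" where
  "forward_step P l z =
     (if z \<in> P \<or> on_side_line P z then None else Some (refl_scale (head P z) l z))"

definition backward_step :: "(real^2) set \<Rightarrow> real \<Rightarrow> real^2 \<Rightarrow> (real^2) option" where
  "backward_step P l z =
     (if z \<in> P \<or> on_side_line P z then None else Some (refl_scale (tail P z) (1 / l) z))"

primrec forward_orbit ::
  "(real^2) set \<Rightarrow> nat \<Rightarrow> (nat \<Rightarrow> real) \<Rightarrow> real^2 \<Rightarrow> nat \<Rightarrow> (real^2) option" where
  "forward_orbit P k l z 0 = Some z"
| "forward_orbit P k l z (Suc n) =
     Option.bind (forward_orbit P k l z n) (forward_step P (refr_index k l (int (Suc n))))"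

text \<open>\<open>backward_orbit P k l z n\<close> is the iterate with index \<open>-n\<close>; passing from index \<open>m = -n\<close>
  to \<open>m - 1\<close> uses the refractive index numbered \<open>m\<close>.\<close>

primrec backward_orbit ::
  "(real^2) set \<Rightarrow> nat \<Rightarrow> (nat \<Rightarrow> real) \<Rightarrow> real^2 \<Rightarrow> nat \<Rightarrow> (real^2) option" where
  "backward_orbit P k l z 0 = Some z"
| "backward_orbit P k l z (Suc n) =
     Option.bind (backward_orbit P k l z n) (backward_step P (refr_index k l (- int n)))"

definition billiard_orbit ::
  "(real^2) set \<Rightarrow> nat \<Rightarrow> (nat \<Rightarrow> real) \<Rightarrow> real^2 \<Rightarrow> int \<Rightarrow> (real^2) option" where
  "billiard_orbit P k l z m =
     (if m \<ge> 0 then forward_orbit P k l z (nat m) else backward_orbit P k l z (nat (- m)))"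

definition strongly_regular ::
  "(real^2) set \<Rightarrow> nat \<Rightarrow> (nat \<Rightarrow> real) \<Rightarrow> real^2 \<Rightarrow> bool" where
  "strongly_regular P k l z \<longleftrightarrow>
     z \<notin> P \<and> (\<forall>m. \<exists>w. billiard_orbit P k l z m = Some w \<and> \<not> on_side_line P w)"

definition periodic_orbit ::
  "(real^2) set \<Rightarrow> nat \<Rightarrow> (nat \<Rightarrow> real) \<Rightarrow> real^2 \<Rightarrow> bool" where
  "periodic_orbit P k l z \<longleftrightarrow>
     (\<exists>N>0. \<forall>m. billiard_orbit P k l z (m + N) = billiard_orbit P k l z m \<and>
                refr_index k l (m + N) = refr_index k l m)"

end

theory Submission imports Defs begin

text \<open>Let \<open>a m = 1 / (\<lambda> 1 \<dots> \<lambda> m)\<close>, a \<open>k\<close>-periodic sequence, and scale the orbit to \<open>Y m = a m z m\<close>.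
  Then \<open>Y m + Y (m - 1) = (a m + a (m - 1)) A m\<close>, where \<open>A m\<close> is at the same time the head about
  \<open>z (m - 1)\<close> and the tail about \<open>z m\<close>. With the origin in the lattice, \<open>Y m\<close> thus stays up to sign in a fixed discrete set, so it suffices to
  bound the orbit; recurrence and the reversibility of the map then give periodicity.

  Far from \<open>P\<close> the contact vertices alternate between an antipodal pair \<open>A\<close>, \<open>B\<close> until the point
  crosses a ray in the direction of a side, and \<open>2 k\<close> steps add \<open>\<plusminus> c0 (B - A)\<close>, where \<open>c0 = a 1 + \<dots> + a (2 k)\<close>. So the
  orbit follows the boundary of a large ball of the norm \<open>u \<mapsto> width of P across u\<close>. Along
  that boundary lie chains of copies of the polygons \<open>\<plusminus> a j P\<close> which touch in vertices and
  are permuted by the map. If the radius \<open>M\<close> is a suitable common multiple, which exists because \<open>P\<close> is rational,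
  the chains along the edges fit together to a closed necklace. Just after crossing a ray a point can only
  interact with two consecutive pearls, and these do not depend on which end of the side is the
  contact vertex; hence no orbit can get from the inside of the necklace to the outside.\<close>

section \<open>The cross product of the plane\<close>

lemma abs_cross2_le: "\<bar>cross2 u v\<bar> \<le> 2 * norm u * norm v"
proof -
  have "\<bar>u$1 * v$2\<bar> \<le> norm u * norm v" "\<bar>u$2 * v$1\<bar> \<le> norm u * norm v"
    by (auto simp: abs_mult intro!: mult_mono component_le_norm_cart)
  then show ?thesis
    unfolding cross2_def by linarith
qed

interpretation cross2: bounded_bilinear cross2
proof
  show "\<exists>K. \<forall>u v. norm (cross2 u v) \<le> norm u * norm v * K"
    using abs_cross2_le by (intro exI[of _ 2] allI) (simp add: mult_ac)
qed (auto simp: cross2_def algebra_simps)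

lemmas cross2_linear =
  cross2.add_left cross2.add_right cross2.diff_left cross2.diff_right
  cross2.scaleR_left cross2.scaleR_right cross2.minus_left cross2.minus_right

lemma cross2_self [simp]: "cross2 u u = 0"
  by (simp add: cross2_def)

lemma cross2_commute: "cross2 u v = - cross2 v u"
  by (simp add: cross2_def)

lemma cross2_eq_0_imp_scaleR:
  assumes "cross2 u d = 0" "u \<noteq> 0"
  obtains t where "d = t *\<^sub>R u"
proof
  have "u$1 \<noteq> 0 \<or> u$2 \<noteq> 0"
    using assms(2) by (simp add: vec_eq_iff forall_2)
  then have pos: "(u$1)^2 + (u$2)^2 \<noteq> 0"
    by (simp add: sum_power2_eq_zero_iff)
  define t where "t = (u$1 * d$1 + u$2 * d$2) / ((u$1)^2 + (u$2)^2)"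
  have *: "u$1 * d$2 = u$2 * d$1"
    using assms(1) by (simp add: cross2_def)
  have "d$1 * ((u$1)^2 + (u$2)^2) = (u$1 * d$1 + u$2 * d$2) * u$1"
       "d$2 * ((u$1)^2 + (u$2)^2) = (u$1 * d$1 + u$2 * d$2) * u$2"
    using * by algebra+
  then have "d$1 = t * u$1" "d$2 = t * u$2"
    using pos by (simp_all add: t_def field_simps)
  then show "d = t *\<^sub>R u"
    by (simp add: vec_eq_iff forall_2)
qed

text \<open>\<open>w\<close> is \<open>u\<close> turned by a right angle. Scaled to the radius of a
  disc inside \<open>P\<close>, it tests inequalities in \<open>cross2 u\<close>.\<close>

lemma ex_cross2_eq_norm:
  obtains w :: "real^2" where "norm w = norm u" "cross2 u w = (norm u)\<^sup>2"
proof -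
  define w :: "real^2" where "w = vector [- u$2, u$1]"
  have "w \<bullet> w = u \<bullet> u" "cross2 u w = u \<bullet> u"
    by (simp_all add: w_def inner_vec_def sum_2 cross2_def)
  then have "norm w = norm u" "cross2 u w = (norm u)\<^sup>2"
    by (simp_all add: norm_eq power2_norm_eq_inner)
  then show thesis by (rule that)
qed

section \<open>Heads and tails\<close>

text \<open>A supporting line that contains two points of \<open>P\<close> cuts out a
  one-dimensional face, so it is the line through a side. This turns degenerate contacts into
  contradictions with regularity.\<close>

lemma on_side_line_if_supporting:
  assumes "convex P" "A \<in> P" "A' \<in> P" "A \<noteq> A'" "u \<noteq> 0"
    and supp: "\<And>p. p \<in> P \<Longrightarrow> 0 \<le> cross2 u (p - A)"
    and "cross2 u (A' - A) = 0" "cross2 u (z - A) = 0"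
  shows "on_side_line P z"
proof -
  define n :: "real^2" where "n = vector [- u$2, u$1]"
  have n: "n \<bullet> x = cross2 u x" for x
    by (simp add: n_def inner_vec_def sum_2 cross2_def)
  have "n \<noteq> 0"
    using \<open>u \<noteq> 0\<close> by (auto simp: n_def vec_eq_iff forall_2)
  define F where "F = P \<inter> {x. n \<bullet> x = n \<bullet> A}"
  have "F face_of P"
    unfolding F_def using supp \<open>convex P\<close>
    by (intro face_of_Int_supporting_hyperplane_ge) (auto simp: n cross2_linear)
  have AF: "{A, A'} \<subseteq> F"
    using assms(2,3,7) by (auto simp: F_def n cross2_linear)
  have "aff_dim F \<le> aff_dim {x. n \<bullet> x = n \<bullet> A}"
    unfolding F_def by (intro aff_dim_subset) auto
  moreover have "aff_dim {A, A'} \<le> aff_dim F"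
    using AF by (rule aff_dim_subset)
  ultimately have "aff_dim F = 1"
    using \<open>n \<noteq> 0\<close> \<open>A \<noteq> A'\<close> by (simp add: aff_dim_hyperplane aff_dim_2)
  with \<open>F face_of P\<close> have "F edge_of P"
    by (simp add: edge_of_def)
  obtain s where s: "A' - A = s *\<^sub>R u"
    using cross2_eq_0_imp_scaleR assms(5,7) by metis
  obtain t where t: "z - A = t *\<^sub>R u"
    using cross2_eq_0_imp_scaleR assms(5,8) by metis
  have "s \<noteq> 0"
    using s \<open>A \<noteq> A'\<close> by auto
  then have "z = A + (t / s) *\<^sub>R (A' - A)"
    using s t by (simp add: algebra_simps)
  then have "z \<in> affine hull {A, A'}"
    unfolding affine_hull_2_alt by blast
  then have "z \<in> affine hull F"
    using hull_mono[OF AF] by blast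
  with \<open>F edge_of P\<close> show ?thesis
    unfolding on_side_line_def by blast
qed

text \<open>By compactness, \<open>P\<close> has an extreme direction as seen from \<open>z\<close>.
  Heads use \<open>\<sigma> = 1\<close> and tails \<open>\<sigma> = - 1\<close>, so one argument
  serves both.\<close>

lemma ex_supporting_vertex:
  fixes P :: "(real^2) set"
  assumes "compact P" "convex P" "P \<noteq> {}" "z \<notin> P"
  obtains A where "A extreme_point_of P" "\<And>p. p \<in> P \<Longrightarrow> \<sigma> * cross2 (A - z) (p - z) \<le> 0"
proof -
  have "closed P"
    using assms(1) by (rule compact_imp_closed)
  then obtain g b where "g \<bullet> z < b" "\<And>p. p \<in> P \<Longrightarrow> b < g \<bullet> p"
    using separating_hyperplane_closed_point[OF assms(2) _ assms(4)] by blast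
  then have gpos: "0 < g \<bullet> (p - z)" if "p \<in> P" for p
    using that by (force simp: inner_diff_right)
  \<comment> \<open>Up to the factor \<open>\<sigma>\<close> this is the tangent of the angle from
    \<open>g\<close> to \<open>p - z\<close>; it is defined on \<open>P\<close> because
    \<open>g\<close> separates \<open>z\<close> from \<open>P\<close>.\<close>
  define f where "f p = \<sigma> * cross2 g (p - z) / (g \<bullet> (p - z))" for p
  have "continuous_on P f"
    unfolding f_def using gpos
    by (intro continuous_intros cross2.continuous_on) force
  then obtain p0 where p0: "p0 \<in> P" "\<And>p. p \<in> P \<Longrightarrow> f p \<le> f p0"
    using continuous_attains_sup[OF assms(1,3)] by blast
  have le0: "\<sigma> * cross2 (p0 - z) (p - z) \<le> 0" if "p \<in> P" for p
  proof -
    have "f p * (g \<bullet> (p - z)) * (g \<bullet> (p0 - z)) \<le> f p0 * (g \<bullet> (p - z)) * (g \<bullet> (p0 - z))"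
      using p0 gpos that by (intro mult_right_mono) (auto simp: less_imp_le)
    then have "\<sigma> * (cross2 g (p - z) * (g \<bullet> (p0 - z)) - cross2 g (p0 - z) * (g \<bullet> (p - z))) \<le> 0"
      using gpos[OF that] gpos[OF p0(1)] by (simp add: f_def field_simps)
    moreover have "cross2 g (p - z) * (g \<bullet> (p0 - z)) - cross2 g (p0 - z) * (g \<bullet> (p - z))
        = (g \<bullet> g) * cross2 (p0 - z) (p - z)"
      by (simp add: cross2_def inner_vec_def sum_2) algebra
    ultimately have "(g \<bullet> g) * (\<sigma> * cross2 (p0 - z) (p - z)) \<le> 0"
      by (simp add: mult.left_commute)
    moreover have "0 < g \<bullet> g"
      using gpos[OF p0(1)] by (auto simp: inner_gt_zero_iff)
    ultimately show ?thesis
      by (simp add: mult_le_0_iff)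
  qed
  define n :: "real^2" where "n = vector [- \<sigma> * (p0 - z)$2, \<sigma> * (p0 - z)$1]"
  have n: "n \<bullet> x = \<sigma> * cross2 (p0 - z) x" for x
    by (simp add: n_def inner_vec_def sum_2 cross2_def algebra_simps)
  \<comment> \<open>\<open>p0\<close> need not be a vertex, so it is exchanged for an extreme point
    of the face \<open>F\<close> through it.\<close>
  define F where "F = P \<inter> {x. n \<bullet> x = n \<bullet> z}"
  have "n \<bullet> x \<le> n \<bullet> z" if "x \<in> P" for x
    using le0[OF that] by (simp add: n cross2_linear algebra_simps)
  then have F: "F face_of P"
    unfolding F_def using assms(2) by (intro face_of_Int_supporting_hyperplane_le) auto
  have p0F: "p0 \<in> F"
    using p0 by (simp add: F_def n cross2_def algebra_simps)
  have "compact F" "convex F"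
    using F assms(1,2) face_of_imp_compact face_of_imp_convex by blast+
  then obtain A where A: "A extreme_point_of F"
    using extreme_point_exists_convex p0F by blast
  then have "A extreme_point_of P" and AF: "A \<in> F"
    using F extreme_point_of_face by blast+
  moreover have "\<sigma> * cross2 (A - z) (p - z) \<le> 0" if "p \<in> P" for p
  proof (cases "\<sigma> = 0")
    case False
    have "cross2 (p0 - z) (A - z) = 0"
      using AF False by (simp add: F_def n cross2_linear)
    moreover have "p0 - z \<noteq> 0"
      using gpos[OF p0(1)] by auto
    ultimately obtain t where t: "A - z = t *\<^sub>R (p0 - z)"
      using cross2_eq_0_imp_scaleR by metis
    have "0 < g \<bullet> (A - z)"
      using gpos AF by (simp add: F_def)
    then have "0 < t"
      using gpos[OF p0(1)] by (simp add: t zero_less_mult_iff)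
    then show ?thesis
      using mult_left_mono[OF le0[OF that], of t] by (simp add: t cross2_linear algebra_simps)
  qed auto
  ultimately show thesis
    using that by blast
qed

text \<open>Two contact vertices would lie with \<open>z\<close> on one supporting line, which would
  be the line through a side.\<close>

lemma supporting_vertex_unique:
  assumes "convex P" "z \<notin> P" "\<not> on_side_line P z" "\<sigma> \<noteq> 0"
    and "A extreme_point_of P" "\<And>p. p \<in> P \<Longrightarrow> \<sigma> * cross2 (A - z) (p - z) \<le> 0"
    and "A' extreme_point_of P" "\<And>p. p \<in> P \<Longrightarrow> \<sigma> * cross2 (A' - z) (p - z) \<le> 0"
  shows "A = A'"
proof (rule ccontr)
  assume "A \<noteq> A'"
  have P: "A \<in> P" "A' \<in> P"
    using assms(5,7) by (auto simp: extreme_point_of_def)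
  have "\<sigma> * cross2 (A - z) (A' - z) \<le> 0" "\<sigma> * cross2 (A' - z) (A - z) \<le> 0"
    using assms(6)[OF P(2)] assms(8)[OF P(1)] by auto
  then have "\<sigma> * cross2 (A - z) (A' - z) = 0"
    by (simp add: cross2_commute[of "A' - z"])
  then have 0: "cross2 (A - z) (A' - z) = 0"
    using assms(4) by simp
  define u where "u = - \<sigma> *\<^sub>R (A - z)"
  have u: "cross2 u x = - \<sigma> * cross2 (A - z) x" for x
    by (simp add: u_def cross2_linear)
  have *: "cross2 (A - z) (p - A) = cross2 (A - z) (p - z)" for p
    by (simp add: cross2_def algebra_simps)
  have "on_side_line P z"
  proof (rule on_side_line_if_supporting[of P A A' u])
    show "u \<noteq> 0"
      using assms(2,4) P by (auto simp: u_def)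
    show "0 \<le> cross2 u (p - A)" if "p \<in> P" for p
      using assms(6)[OF that] by (simp add: u *)
    show "cross2 u (z - A) = 0"
      by (simp add: u_def cross2_def algebra_simps)
  qed (use assms(1) P \<open>A \<noteq> A'\<close> 0 in \<open>auto simp: u * cross2.zero_right simp del: diff_self\<close>)
  with assms(3) show False ..
qed

lemma supporting_iff:
  assumes "z \<notin> P" "A \<in> P"
  shows "(\<exists>d. right_supporting P z d \<and> A \<in> ray z d) \<longleftrightarrow> (\<forall>p\<in>P. cross2 (A - z) (p - z) \<le> 0)"
    and "(\<exists>d. left_supporting P z d \<and> A \<in> ray z d) \<longleftrightarrow> (\<forall>p\<in>P. 0 \<le> cross2 (A - z) (p - z))"
proof -
  have ray: "A \<in> ray z (A - z)"
    unfolding ray_def by (rule CollectI, rule exI[of _ 1]) auto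
  have "A - z \<noteq> 0"
    using assms by auto
  have pos: "\<exists>t\<ge>0. A - z = t *\<^sub>R d" if "A \<in> ray z d" for d
    using that unfolding ray_def by auto
  show "(\<exists>d. right_supporting P z d \<and> A \<in> ray z d) \<longleftrightarrow> (\<forall>p\<in>P. cross2 (A - z) (p - z) \<le> 0)"
  proof
    assume "\<exists>d. right_supporting P z d \<and> A \<in> ray z d"
    then obtain d t where "right_supporting P z d" "0 \<le> t" "A - z = t *\<^sub>R d"
      using pos by blast
    then show "\<forall>p\<in>P. cross2 (A - z) (p - z) \<le> 0"
      by (simp add: right_supporting_def cross2.scaleR_left mult_nonneg_nonpos)
  next
    assume "\<forall>p\<in>P. cross2 (A - z) (p - z) \<le> 0"
    then have "right_supporting P z (A - z)"
      using ray \<open>A \<in> P\<close> \<open>A - z \<noteq> 0\<close> by (auto simp: right_supporting_def)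
    with ray show "\<exists>d. right_supporting P z d \<and> A \<in> ray z d" by blast
  qed
  show "(\<exists>d. left_supporting P z d \<and> A \<in> ray z d) \<longleftrightarrow> (\<forall>p\<in>P. 0 \<le> cross2 (A - z) (p - z))"
  proof
    assume "\<exists>d. left_supporting P z d \<and> A \<in> ray z d"
    then obtain d t where "left_supporting P z d" "0 \<le> t" "A - z = t *\<^sub>R d"
      using pos by blast
    then show "\<forall>p\<in>P. 0 \<le> cross2 (A - z) (p - z)"
      by (simp add: left_supporting_def cross2.scaleR_left)
  next
    assume "\<forall>p\<in>P. 0 \<le> cross2 (A - z) (p - z)"
    then have "left_supporting P z (A - z)"
      using ray \<open>A \<in> P\<close> \<open>A - z \<noteq> 0\<close> by (auto simp: left_supporting_def)
    with ray show "\<exists>d. left_supporting P z d \<and> A \<in> ray z d" by blast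
  qed
qed

lemma head_eq_iff:
  assumes "compact P" "convex P" "P \<noteq> {}" "z \<notin> P" "\<not> on_side_line P z"
  shows "head P z = A \<longleftrightarrow> A extreme_point_of P \<and> (\<forall>p\<in>P. cross2 (A - z) (p - z) \<le> 0)"
proof -
  let ?Q = "\<lambda>A. A extreme_point_of P \<and> (\<forall>p\<in>P. cross2 (A - z) (p - z) \<le> 0)"
  have "head P z = (THE A. ?Q A)"
    unfolding head_def
    by (rule arg_cong[of _ _ The], rule ext)
       (use supporting_iff[OF assms(4)] in \<open>auto simp: extreme_point_of_def\<close>)
  moreover have "\<exists>!A. ?Q A"
  proof (rule ex_ex1I)
    obtain A where "A extreme_point_of P" "\<And>p. p \<in> P \<Longrightarrow> 1 * cross2 (A - z) (p - z) \<le> 0"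
      using ex_supporting_vertex[OF assms(1-4), of 1] by blast
    then show "\<exists>A. ?Q A" by auto
    show "A = A'" if "?Q A" "?Q A'" for A A'
      using that by (intro supporting_vertex_unique[OF assms(2,4,5), of 1]) auto
  qed
  ultimately show ?thesis
    using theI'[of ?Q] the1_equality[of ?Q A] by auto
qed

lemma tail_eq_iff:
  assumes "compact P" "convex P" "P \<noteq> {}" "z \<notin> P" "\<not> on_side_line P z"
  shows "tail P z = A \<longleftrightarrow> A extreme_point_of P \<and> (\<forall>p\<in>P. 0 \<le> cross2 (A - z) (p - z))"
proof -
  let ?Q = "\<lambda>A. A extreme_point_of P \<and> (\<forall>p\<in>P. 0 \<le> cross2 (A - z) (p - z))"
  have "tail P z = (THE A. ?Q A)"
    unfolding tail_def
    by (rule arg_cong[of _ _ The], rule ext)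
       (use supporting_iff[OF assms(4)] in \<open>auto simp: extreme_point_of_def\<close>)
  moreover have "\<exists>!A. ?Q A"
  proof (rule ex_ex1I)
    obtain A where "A extreme_point_of P" "\<And>p. p \<in> P \<Longrightarrow> - 1 * cross2 (A - z) (p - z) \<le> 0"
      using ex_supporting_vertex[OF assms(1-4), of "-1"] by blast
    then show "\<exists>A. ?Q A" by auto
    show "A = A'" if "?Q A" "?Q A'" for A A'
      using that by (intro supporting_vertex_unique[OF assms(2,4,5), of "-1"]) auto
  qed
  ultimately show ?thesis
    using theI'[of ?Q] the1_equality[of ?Q A] by auto
qed

section \<open>Chains of pearls\<close>

definition ncone :: "(real^2) set \<Rightarrow> real^2 \<Rightarrow> real^2 \<Rightarrow> (real^2) set" where
  "ncone P A B = {d. \<forall>p\<in>P. 0 \<le> cross2 d (p - A) \<and> 0 \<le> cross2 d (B - p)}"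

lemma ncone_uminus_iff: "- d \<in> ncone P A B \<longleftrightarrow> d \<in> ncone P B A"
  by (auto simp: ncone_def cross2_linear)

lemma ncone_scaleR: "0 \<le> t \<Longrightarrow> d \<in> ncone P A B \<Longrightarrow> t *\<^sub>R d \<in> ncone P A B"
  by (auto simp: ncone_def cross2.scaleR_left)

text \<open>Contact inequalities of an orbit point have this form: they are those of
  \<open>ncone P A B\<close> and \<open>ncone P A' B\<close> up to displacements by multiples of
  vertices, which are bounded.\<close>

definition approx_ncone :: "real \<Rightarrow> (real^2) set \<Rightarrow> real^2 \<Rightarrow> real^2 \<Rightarrow> real^2 \<Rightarrow> (real^2) set" where
  "approx_ncone \<kappa> P A A' B = {Y. \<exists>v1 v2 v3. norm v1 \<le> \<kappa> \<and> norm v2 \<le> \<kappa> \<and> norm v3 \<le> \<kappa> \<and>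
     (\<forall>p\<in>P. 0 \<le> cross2 (Y - v1) (p - A) \<and> 0 \<le> cross2 (Y - v2) (p - A') \<and> 0 \<le> cross2 (Y - v3) (B - p))}"

text \<open>Normalise a sequence escaping to infinity and pass to a limit on the unit circle: the
  bounded displacements vanish and the exact inequalities remain.\<close>

lemma approx_ncone_unbounded_imp:
  assumes unbounded: "\<And>n::nat. \<exists>Y \<in> approx_ncone \<kappa> P A A' B. real n < norm Y"
  shows "\<exists>u. u \<noteq> 0 \<and> u \<in> ncone P A B \<and> u \<in> ncone P A' B"
proof -
  define bad where "bad Y v1 v2 v3 \<longleftrightarrow> norm v1 \<le> \<kappa> \<and> norm v2 \<le> \<kappa> \<and> norm v3 \<le> \<kappa> \<and>
      (\<forall>p\<in>P. 0 \<le> cross2 (Y - v1) (p - A) \<and> 0 \<le> cross2 (Y - v2) (p - A') \<and> 0 \<le> cross2 (Y - v3) (B - p))"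
    for Y v1 v2 v3
  obtain Y where Y: "\<And>n. Y n \<in> approx_ncone \<kappa> P A A' B" "\<And>n. real n < norm (Y n)"
    using unbounded by metis
  have "\<exists>v1 v2 v3. bad (Y n) v1 v2 v3" for n
    using Y(1)[of n] unfolding approx_ncone_def bad_def by blast
  then obtain v1 v2 v3 where bad: "\<And>n. bad (Y n) (v1 n) (v2 n) (v3 n)"
    by metis
  define e where "e n = Y n /\<^sub>R norm (Y n)" for n
  have Ypos: "0 < norm (Y n)" for n
    using Y(2)[of n] by (rule order_le_less_trans[OF of_nat_0_le_iff])
  have "e n \<in> sphere 0 1" for n
    using Ypos[of n] by (simp add: e_def)
  then obtain u r where u: "u \<in> sphere 0 1" and r: "strict_mono r" and lim: "(e \<circ> r) \<longlonglongrightarrow> u"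
    using compact_sphere[of "0 :: real^2" 1] unfolding compact_def by blast
  have limv: "(\<lambda>n. (Y (r n) - v (r n)) /\<^sub>R norm (Y (r n))) \<longlonglongrightarrow> u" if v: "\<And>n. norm (v n) \<le> \<kappa>" for v
  proof -
    have "(\<lambda>n. v n /\<^sub>R norm (Y n)) \<longlonglongrightarrow> 0"
    proof (rule Lim_null_comparison)
      show "\<forall>\<^sub>F n in sequentially. norm (v n /\<^sub>R norm (Y n)) \<le> \<bar>\<kappa>\<bar> / real n"
      proof (rule eventually_sequentiallyI[of 1])
        fix n :: nat assume "1 \<le> n"
        moreover have "real n < norm (Y n)"
          by (rule Y(2))
        ultimately have "norm (v n) / norm (Y n) \<le> \<bar>\<kappa>\<bar> / real n"
          using v[of n] by (intro frac_le) auto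
        then show "norm (v n /\<^sub>R norm (Y n)) \<le> \<bar>\<kappa>\<bar> / real n"
          by (simp add: divide_inverse mult.commute)
      qed
      show "(\<lambda>n. \<bar>\<kappa>\<bar> / real n) \<longlonglongrightarrow> 0"
        by (rule lim_const_over_n)
    qed
    from tendsto_diff[OF lim LIMSEQ_subseq_LIMSEQ[OF this r]] show ?thesis
      by (simp add: o_def e_def scaleR_right_diff_distrib)
  qed
  have nonneg: "0 \<le> cross2 u d"
    if v: "\<And>n. norm (v n) \<le> \<kappa>" and d: "\<And>n. 0 \<le> cross2 (Y n - v n) d" for v d
  proof (rule tendsto_lowerbound)
    show "(\<lambda>n. cross2 ((Y (r n) - v (r n)) /\<^sub>R norm (Y (r n))) d) \<longlonglongrightarrow> cross2 u d"
      by (intro cross2.tendsto limv v tendsto_const)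
    show "\<forall>\<^sub>F n in sequentially. 0 \<le> cross2 ((Y (r n) - v (r n)) /\<^sub>R norm (Y (r n))) d"
      using d by (auto simp: cross2.scaleR_left)
  qed auto
  have "0 \<le> cross2 u (p - A)" "0 \<le> cross2 u (p - A')" "0 \<le> cross2 u (B - p)" if "p \<in> P" for p
    using that bad nonneg[of v1 "p - A"] nonneg[of v2 "p - A'"] nonneg[of v3 "B - p"]
    by (auto simp: bad_def)
  then have "u \<in> ncone P A B" "u \<in> ncone P A' B"
    by (auto simp: ncone_def)
  moreover have "u \<noteq> 0" using u by auto
  ultimately show ?thesis by blast
qed

section \<open>Pearls for a positive periodic weight sequence\<close>

locale refractive_table =
  fixes P :: "(real^2) set" and k :: nat and a :: "int \<Rightarrow> real"
  assumes polytope_P: "polytope P" and interior_P: "interior P \<noteq> {}"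
    and k_pos: "0 < k"
    and a_pos: "0 < a j" and a_periodic: "a (j + int k) = a j"
begin

lemma convex_P: "convex P" and compact_P: "compact P"
  using polytope_P polytope_imp_convex polytope_imp_compact by blast+

text \<open>Signed partial sums, so that the increment at \<open>j\<close> is \<open>a j\<close> for
  negative \<open>j\<close> as well.\<close>

definition S :: "int \<Rightarrow> real" where
  "S j = (if 0 \<le> j then sum a {1..j} else - sum a {j+1..0})"

lemma S_step: "S j = S (j - 1) + a j"
proof (cases "1 \<le> j")
  case True
  then have "{1..j} = insert j {1..j-1}" by auto
  with True show ?thesis by (simp add: S_def)
next
  case False
  then have "{j..0} = insert j {j+1..0}" by auto
  with False show ?thesis by (cases "j = 0") (auto simp: S_def)
qed

lemma S_mono: "i \<le> j \<Longrightarrow> S i \<le> S j"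
proof (induction j rule: int_ge_induct)
  case (step j)
  then show ?case
    using S_step[of "j + 1"] a_pos[of "j + 1"] by simp
qed simp

text \<open>The period is \<open>2 * k\<close> and not \<open>k\<close>, because pearls alternate in
  orientation and only an even shift preserves it.\<close>

definition c0 :: real where "c0 = S (2 * int k)"

lemma c0_pos: "0 < c0"
proof -
  have "{1..2 * int k} \<noteq> {}" using k_pos by simp
  then show ?thesis
    unfolding c0_def S_def by (auto intro!: sum_pos a_pos)
qed

lemma a_periodic_mult: "a (j + m * int k) = a j"
proof (induction m rule: int_induct[where k = 0])
  case (step1 m)
  then show ?case using a_periodic[of "j + m * int k"] by (simp add: algebra_simps)
next
  case (step2 m)
  then show ?case using a_periodic[of "j + (m - 1) * int k"] by (simp add: algebra_simps)
qed simp

lemma a_mod: "a (j mod int k) = a j"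
  using a_periodic_mult[of "j mod int k" "j div int k"] by (simp add: mult.commute)

lemma finite_range_a: "finite (range a)"
proof -
  have "a j \<in> a ` {0..<int k}" for j
    using k_pos a_mod[of j] by (intro image_eqI[of _ _ "j mod int k"]) auto
  then have "range a \<subseteq> a ` {0..<int k}"
    by blast
  then show ?thesis
    by (rule finite_subset) auto
qed

lemma S_periodic: "S (j + 2 * int k) = S j + c0"
proof (induction j rule: int_induct[where k = 0])
  case base
  show ?case by (simp add: c0_def S_def)
next
  case (step1 j)
  then show ?case
    using S_step[of "j + 1"] S_step[of "j + 1 + 2 * int k"] a_periodic_mult[of "j + 1" 2]
    by (simp add: algebra_simps)
next
  case (step2 j)
  then show ?case
    using S_step[of j] S_step[of "j + 2 * int k"] a_periodic_mult[of j 2]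
    by (simp add: algebra_simps)
qed

lemma S_periodic_mult: "S (j + m * (2 * int k)) = S j + of_int m * c0"
proof (induction m rule: int_induct[where k = 0])
  case (step1 m)
  then show ?case using S_periodic[of "j + m * (2 * int k)"] by (simp add: algebra_simps)
next
  case (step2 m)
  then show ?case using S_periodic[of "j + (m - 1) * (2 * int k)"] by (simp add: algebra_simps)
qed simp

text \<open>While the contact vertices alternate between \<open>A\<close> and \<open>B\<close>, the polygon \<open>\<plusminus> a j P\<close> at time
  \<open>j\<close>, transported to time \<open>n\<close>, is \<open>pearl n A B j\<close>. Consecutive pearls meet in a single point:
  \<open>touch n A B j\<close> is common to the pearls \<open>j\<close> and \<open>j + 1\<close>.\<close>

definition touch :: "int \<Rightarrow> real^2 \<Rightarrow> real^2 \<Rightarrow> int \<Rightarrow> real^2" where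
  "touch n A B j = a n *\<^sub>R A + (S j - S n) *\<^sub>R (A - B)"

definition pearl :: "int \<Rightarrow> real^2 \<Rightarrow> real^2 \<Rightarrow> int \<Rightarrow> (real^2) set" where
  "pearl n A B j =
     (if even (j - n) then (\<lambda>p. touch n A B j + a j *\<^sub>R (p - A)) ` P
      else (\<lambda>p. touch n A B j - a j *\<^sub>R (p - B)) ` P)"

text \<open>The points on the outer side of the chain of pearls, \<open>x\<close> being a point of the barrier curve
  to which the chain is translated.\<close>

definition outer :: "int \<Rightarrow> real^2 \<Rightarrow> real^2 \<Rightarrow> real^2 \<Rightarrow> (real^2) set" where
  "outer n A B x = {x + q + c | j q c. q \<in> pearl n A B j \<and> c \<in> ncone P A B}"

lemma touch_diff: "touch n A B i = touch n A B j + (S j - S i) *\<^sub>R (B - A)"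
  by (simp add: touch_def algebra_simps)

lemma touch_pred: "touch n A B (j - 1) = touch n A B j + a j *\<^sub>R (B - A)"
  using touch_diff[of n A B "j - 1" j] S_step[of j] by simp

lemma pearl_cases:
  assumes "q \<in> pearl n A B j"
  obtains p where "p \<in> P" "even (j - n)" "q = touch n A B j + a j *\<^sub>R (p - A)"
  | p where "p \<in> P" "odd (j - n)" "q = touch n A B j - a j *\<^sub>R (p - B)"
  using assms unfolding pearl_def by (auto split: if_splits)

lemma touch_pred_in_pearl:
  assumes "A \<in> P" "B \<in> P"
  shows "touch n A B (j - 1) \<in> pearl n A B j"
proof (cases "even (j - n)")
  case True
  then show ?thesis
    using assms by (auto simp: pearl_def touch_pred intro!: image_eqI[of _ _ B])
next
  case False
  then show ?thesis
    using assms by (auto simp: pearl_def touch_pred algebra_simps intro!: image_eqI[of _ _ A])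
qed

lemma convex_pearl: "convex (pearl n A B j)"
proof -
  have "(\<lambda>p. touch n A B j + a j *\<^sub>R (p - A)) = (\<lambda>p. (touch n A B j - a j *\<^sub>R A) + a j *\<^sub>R p)"
    "(\<lambda>p. touch n A B j - a j *\<^sub>R (p - B)) = (\<lambda>p. (touch n A B j + a j *\<^sub>R B) + (- a j) *\<^sub>R p)"
    by (auto simp: algebra_simps)
  then show ?thesis
    unfolding pearl_def using convex_P by (simp only: convex_affinity split: if_split) blast
qed

lemma touch_height_mono:
  assumes "d \<in> ncone P A B" "A \<in> P" "i \<le> j"
  shows "cross2 d (touch n A B j) \<le> cross2 d (touch n A B i)"
  using assms S_mono[of i j] touch_diff[of n A B i j]
  by (auto simp: ncone_def cross2.add_right cross2.scaleR_right)

text \<open>An upright pearl is lowest at its copy of \<open>A\<close> and highest at its copy of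
  \<open>B\<close>, a reflected one conversely; in both cases these are its two touching
  points.\<close>

lemma pearl_height:
  assumes "d \<in> ncone P A B" "q \<in> pearl n A B j"
  shows "cross2 d (touch n A B j) \<le> cross2 d q"
    and "cross2 d q \<le> cross2 d (touch n A B (j - 1))"
proof -
  have "0 < a j" by (rule a_pos)
  then have scaled: "0 \<le> cross2 d (a j *\<^sub>R (p - A))" "0 \<le> cross2 d (a j *\<^sub>R (B - p))" if "p \<in> P" for p
    using assms(1) that by (auto simp: ncone_def cross2.scaleR_right)
  obtain e1 e2 where e: "q = touch n A B j + e1" "q + e2 = touch n A B (j - 1)"
    "0 \<le> cross2 d e1" "0 \<le> cross2 d e2"
    using assms(2)
  proof (cases rule: pearl_cases)
    case (1 p)
    then show thesis
      by (intro that[of "a j *\<^sub>R (p - A)" "a j *\<^sub>R (B - p)"] scaled)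
         (auto simp: touch_pred algebra_simps)
  next
    case (2 p)
    then show thesis
      by (intro that[of "a j *\<^sub>R (B - p)" "a j *\<^sub>R (p - A)"] scaled)
         (auto simp: touch_pred algebra_simps)
  qed
  show "cross2 d (touch n A B j) \<le> cross2 d q"
    using e(1,3) by (simp add: cross2.add_right)
  show "cross2 d q \<le> cross2 d (touch n A B (j - 1))"
    using e(2,4) cross2.add_right[of d q e2] by simp
qed

text \<open>One step of the scaled orbit is a point reflection, here run backwards in time. It turns
  every pearl over and exchanges \<open>A\<close> and \<open>B\<close>, but keeps the index
  \<open>j\<close>.\<close>

lemma outer_reflect:
  assumes "Y \<in> outer n A B x"
  shows "(a n + a (n - 1)) *\<^sub>R B - Y \<in> outer (n - 1) B A (- x)"
proof -
  obtain j q c where Y: "Y = x + q + c" and q: "q \<in> pearl n A B j" and c: "c \<in> ncone P A B"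
    using assms unfolding outer_def by blast
  have touch: "touch (n - 1) B A j = (a n + a (n - 1)) *\<^sub>R B - touch n A B j"
    using S_step[of n] by (simp add: touch_def algebra_simps)
  have "(a n + a (n - 1)) *\<^sub>R B - q \<in> pearl (n - 1) B A j"
    using q
  proof (cases rule: pearl_cases)
    case (1 p)
    then show ?thesis
      by (auto simp: pearl_def touch algebra_simps intro!: image_eqI[of _ _ p])
  next
    case (2 p)
    then show ?thesis
      by (auto simp: pearl_def touch algebra_simps intro!: image_eqI[of _ _ p])
  qed
  moreover have "- c \<in> ncone P B A"
    using c by (simp add: ncone_uminus_iff)
  moreover have "(a n + a (n - 1)) *\<^sub>R B - Y = - x + ((a n + a (n - 1)) *\<^sub>R B - q) + - c"
    by (simp add: Y)
  ultimately show ?thesis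
    unfolding outer_def by blast
qed

text \<open>The translation renumbers the pearls by a multiple of \<open>2 * k\<close>, so the chain
  as a whole is unchanged.\<close>

lemma outer_shift:
  assumes "Y \<in> outer n A B (x + (of_int m * c0) *\<^sub>R (A - B))"
  shows "Y \<in> outer n A B x"
proof -
  obtain j q c where Y: "Y = x + (of_int m * c0) *\<^sub>R (A - B) + q + c"
    and q: "q \<in> pearl n A B j" and c: "c \<in> ncone P A B"
    using assms unfolding outer_def by blast
  let ?j = "j + m * (2 * int k)"
  have a_mult: "a ?j = a j"
    using a_periodic_mult[of j "2 * m"] by (simp add: algebra_simps)
  have touch: "touch n A B ?j = touch n A B j + (of_int m * c0) *\<^sub>R (A - B)"
    unfolding touch_def S_periodic_mult by (simp add: algebra_simps)
  have "q + (of_int m * c0) *\<^sub>R (A - B) \<in> pearl n A B ?j"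
    using q unfolding pearl_def touch a_mult
    by (auto simp: algebra_simps split: if_splits)
  moreover have "Y = x + (q + (of_int m * c0) *\<^sub>R (A - B)) + c"
    by (simp add: Y)
  ultimately show ?thesis
    unfolding outer_def using c by blast
qed

text \<open>Pearls deviate from the axis of the chain by at most \<open>c * W\<close>, and cone
  directions only lead outwards. Points of low energy are therefore never outer.\<close>

lemma outer_cross2_ge:
  assumes "Y \<in> outer n A B x" "A \<in> P" "B \<in> P"
    and "\<And>p q. p \<in> P \<Longrightarrow> q \<in> P \<Longrightarrow> \<bar>cross2 (p - q) (B - A)\<bar> \<le> W" and "\<And>j. a j \<le> c"
  shows "cross2 x (B - A) - c * W \<le> cross2 (Y - a n *\<^sub>R A) (B - A)"
proof -
  obtain j q d where Y: "Y = x + q + d" and q: "q \<in> pearl n A B j" and d: "d \<in> ncone P A B"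
    using assms(1) unfolding outer_def by blast
  have touch: "cross2 (touch n A B j - a n *\<^sub>R A) (B - A) = 0"
    by (simp add: touch_def cross2_def algebra_simps)
  have "\<bar>cross2 (q - a n *\<^sub>R A) (B - A)\<bar> \<le> a j * W"
    using q
  proof (cases rule: pearl_cases)
    case (1 p)
    then have "q - a n *\<^sub>R A = (touch n A B j - a n *\<^sub>R A) + a j *\<^sub>R (p - A)"
      by simp
    then have "cross2 (q - a n *\<^sub>R A) (B - A) = a j * cross2 (p - A) (B - A)"
      using touch by (simp only: cross2.add_left cross2.scaleR_left) simp
    then show ?thesis
      using assms(2,4) 1 a_pos[of j] by (simp add: abs_mult)
  next
    case (2 p)
    then have "q - a n *\<^sub>R A = (touch n A B j - a n *\<^sub>R A) + a j *\<^sub>R (B - p)"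
      by (simp add: algebra_simps)
    then have "cross2 (q - a n *\<^sub>R A) (B - A) = a j * cross2 (B - p) (B - A)"
      using touch by (simp only: cross2.add_left cross2.scaleR_left) simp
    then show ?thesis
      using assms(3,4) 2 a_pos[of j] by (simp add: abs_mult)
  qed
  also have "a j * W \<le> c * W"
    using assms(4)[OF assms(2,2)] assms(5) by (intro mult_right_mono) auto
  finally have "\<bar>cross2 (q - a n *\<^sub>R A) (B - A)\<bar> \<le> c * W" .
  moreover have "0 \<le> cross2 d (B - A)"
    using d assms(2) by (auto simp: ncone_def)
  moreover have "cross2 (Y - a n *\<^sub>R A) (B - A)
      = cross2 x (B - A) + cross2 (q - a n *\<^sub>R A) (B - A) + cross2 d (B - A)"
    by (simp add: Y cross2_linear)
  ultimately show ?thesis by linarith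
qed

lemma pearl_self: "pearl n A B n = (\<lambda>p. a n *\<^sub>R p) ` P"
  by (auto simp: pearl_def touch_def algebra_simps)

lemma pearl_pred: "pearl n A B (n - 1) = (\<lambda>p. a n *\<^sub>R B - a (n - 1) *\<^sub>R (p - B)) ` P"
  using S_step[of n] by (auto simp: pearl_def touch_def algebra_simps)

text \<open>The copies of the chord \<open>A B\<close> in the pearls \<open>n\<close> and
  \<open>n - 1\<close> join to one segment. These two pearls do not depend on their first vertex, so
  \<open>A'\<close> is arbitrary.\<close>

lemma spine_in_pearl:
  assumes "A \<in> P" "B \<in> P" "0 \<le> \<xi>" "\<xi> \<le> a n + a (n - 1)"
  obtains j where "j \<in> {n - 1, n}" "a n *\<^sub>R A + \<xi> *\<^sub>R (B - A) \<in> pearl n A' B j"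
proof (cases "\<xi> \<le> a n")
  case True
  have "A + (\<xi> / a n) *\<^sub>R (B - A) = (1 - \<xi> / a n) *\<^sub>R A + (\<xi> / a n) *\<^sub>R B"
    by (simp add: algebra_simps)
  also have "\<dots> \<in> P"
    using assms True a_pos[of n] convex_P by (intro convexD) auto
  finally have "a n *\<^sub>R A + \<xi> *\<^sub>R (B - A) \<in> pearl n A' B n"
    using a_pos[of n]
    by (auto simp: pearl_self scaleR_add_right intro!: image_eqI[of _ _ "A + (\<xi> / a n) *\<^sub>R (B - A)"])
  then show thesis using that by blast
next
  case False
  define t where "t = (\<xi> - a n) / a (n - 1)"
  have t: "0 \<le> t" "t \<le> 1" "\<xi> = a n + t * a (n - 1)"
    using False assms(4) a_pos[of "n - 1"] by (auto simp: t_def field_simps)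
  have "(1 - t) *\<^sub>R B + t *\<^sub>R A \<in> P"
    using assms t convex_P by (intro convexD) auto
  then have "a n *\<^sub>R A + \<xi> *\<^sub>R (B - A) \<in> pearl n A' B (n - 1)"
    by (auto simp: pearl_pred t algebra_simps intro!: image_eqI[of _ _ "(1 - t) *\<^sub>R B + t *\<^sub>R A"])
  then show thesis using that by blast
qed

lemma pearl_eq_across_ray: "j \<in> {n - 1, n} \<Longrightarrow> pearl n A B j = pearl n A' B j"
  by (auto simp: pearl_self pearl_pred)

text \<open>Between the line through the side \<open>A A'\<close> and its translate at the height of the top of
  pearl \<open>n - 1\<close> only the pearls \<open>n\<close> and \<open>n - 1\<close> matter, and these do not depend on the choice
  between \<open>A\<close> and \<open>A'\<close>.\<close>

lemma outer_across_ray: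
  assumes "A \<in> P" "A' \<in> P" "B \<in> P"
    and u: "A' - A \<in> ncone P A B" and w: "0 < cross2 (A' - A) (B - A)"
    and x: "x = s *\<^sub>R (A' - A)"
    and Y: "Y \<in> outer n A' B x"
    and h: "0 < cross2 (A' - A) (Y - a n *\<^sub>R A')"
      "cross2 (A' - A) (Y - a n *\<^sub>R A') < (a n + a (n - 1)) * cross2 (A' - A) (B - A)"
  shows "Y \<in> outer n A B x"
proof -
  define u where "u = A' - A"
  have uA: "u \<in> ncone P A B" using u by (simp add: u_def)
  have swap: "cross2 u (p - A') = cross2 u (p - A)" for p
    by (simp add: u_def cross2_def algebra_simps)
  have uA': "u \<in> ncone P A' B"
    using uA by (simp add: ncone_def swap)
  have w': "0 < cross2 u (B - A')"
    using w swap[of B] by (simp add: u_def)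
  obtain j q c where Yeq: "Y = x + q + c" and q: "q \<in> pearl n A' B j" and c: "c \<in> ncone P A' B"
    using Y unfolding outer_def by blast
  have uc: "0 \<le> cross2 u c"
    using c assms(1) cross2_commute[of c "A - A'"] by (auto simp: ncone_def u_def cross2_linear)
  \<comment> \<open>The height above the line through the side, scaled by \<open>a n\<close>; moving
    along \<open>u\<close>, and in particular by \<open>x\<close>, does not change it.\<close>
  define H where "H v = cross2 u (v - a n *\<^sub>R A')" for v
  have ux: "cross2 u x = 0"
    by (simp add: x u_def cross2.scaleR_right)
  have HY: "H Y = H q + cross2 u c"
    by (simp add: H_def Yeq cross2_linear ux)
  have h': "0 < H Y" "H Y < (a n + a (n - 1)) * cross2 u (B - A')"
    using h swap[of B] by (simp_all add: H_def u_def)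
  have Htouch: "H (touch n A' B i) = (S n - S i) * cross2 u (B - A')" for i
    by (simp add: H_def touch_def cross2_linear algebra_simps)
  \<comment> \<open>\<open>touch n A' B (n - 2)\<close> is the top of pearl \<open>n - 1\<close>. As
    \<open>Y\<close> lies below it, pearl \<open>j\<close> starts below it too.\<close>
  have "S (n - 2) = S n - a n - a (n - 1)"
    using S_step[of n] S_step[of "n - 1"] by simp
  then have "H Y < H (touch n A' B (n - 2))"
    using h' by (simp add: Htouch)
  moreover have Hq: "H (touch n A' B j) \<le> H q" "H q \<le> H (touch n A' B (j - 1))"
    using pearl_height[OF uA' q] by (simp_all add: H_def cross2.diff_right)
  ultimately have "H (touch n A' B j) < H (touch n A' B (n - 2))"
    using HY uc by linarith
  then have j: "n - 1 \<le> j"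
    using touch_height_mono[OF uA' \<open>A' \<in> P\<close>, of j "n - 2" n]
    by (force simp: H_def cross2.diff_right)
  have in_two: "j \<in> {n - 1, n}" if "0 < H (touch n A' B (j - 1))"
  proof -
    have "S (j - 1) < S n"
      using that w' by (simp add: Htouch zero_less_mult_iff)
    then have "j - 1 < n"
      using S_mono[of n "j - 1"] by force
    with j show ?thesis by auto
  qed
  \<comment> \<open>It suffices to reach \<open>Y\<close> along \<open>u\<close> from a point of the
    two pearls common to both chains, since \<open>u\<close> lies in the cone for \<open>A\<close>
    as well.\<close>
  have finish: "Y \<in> outer n A B x"
    if "j' \<in> {n - 1, n}" "q' \<in> pearl n A' B j'" "Y - x - q' = \<nu> *\<^sub>R u" "0 \<le> \<nu>" for j' q' \<nu>
  proof -
    have "Y = x + q' + \<nu> *\<^sub>R u"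
      using that(3) by (simp add: algebra_simps)
    moreover have "q' \<in> pearl n A B j'"
      using that pearl_eq_across_ray by metis
    ultimately show ?thesis
      unfolding outer_def using ncone_scaleR[OF that(4) uA] by blast
  qed
  have "u \<noteq> 0" using w' by (auto simp: cross2.zero_left)
  show ?thesis
  proof (cases "cross2 u c = 0")
    case True
    obtain \<nu> where \<nu>: "c = \<nu> *\<^sub>R u"
      using cross2_eq_0_imp_scaleR[OF True \<open>u \<noteq> 0\<close>] .
    have "0 \<le> cross2 c (B - A')"
      using c assms(2) by (auto simp: ncone_def)
    then have "0 \<le> \<nu>"
      using w' by (simp add: \<nu> cross2.scaleR_left zero_le_mult_iff)
    moreover have "j \<in> {n - 1, n}"
      using in_two Hq HY True h' by linarith
    moreover have "Y - x - q = \<nu> *\<^sub>R u"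
      by (simp add: Yeq \<nu>)
    ultimately show ?thesis
      using finish[OF _ q] by blast
  next
    case False
    then have uc_pos: "0 < cross2 u c" using uc by simp
    \<comment> \<open>As \<open>cross2 u c\<close> is positive, the sign condition against
      \<open>c\<close> says that \<open>Y\<close> lies beyond \<open>x + q'\<close> in the direction
      \<open>u\<close>.\<close>
    have finish': "Y \<in> outer n A B x"
      if "j' \<in> {n - 1, n}" "q' \<in> pearl n A' B j'" "H q' = H Y" "cross2 c (Y - x - q') \<le> 0" for j' q'
    proof -
      have "cross2 u (Y - x - q') = 0"
        using that(3) by (simp add: H_def cross2_linear ux)
      then obtain \<nu> where \<nu>: "Y - x - q' = \<nu> *\<^sub>R u"
        using cross2_eq_0_imp_scaleR \<open>u \<noteq> 0\<close> by metis
      have "\<nu> * cross2 c u \<le> 0"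
        using that(4) by (simp add: \<nu> cross2.scaleR_right)
      then have "0 \<le> \<nu>"
        using uc_pos cross2_commute[of c u] by (simp add: mult_le_0_iff zero_le_mult_iff)
      then show ?thesis
        using finish that(1,2) \<nu> by blast
    qed
    let ?T = "touch n A' B (j - 1)"
    have cT: "cross2 c q \<le> cross2 c ?T"
      using pearl_height(2)[OF c q] .
    show ?thesis
    proof (cases "H Y \<le> H ?T")
      case True
      \<comment> \<open>Slide from \<open>q\<close> towards the top of pearl \<open>j\<close> up to
        the height of \<open>Y\<close>; convexity keeps the point in the pearl.\<close>
      define \<theta> where "\<theta> = cross2 u c / (H ?T - H q)"
      have pos: "0 < H ?T - H q" using True HY uc_pos by simp
      have \<theta>: "0 \<le> \<theta>" "\<theta> \<le> 1" "\<theta> * (H ?T - H q) = cross2 u c"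
        using pos True HY uc_pos by (auto simp: \<theta>_def)
      define q' where "q' = (1 - \<theta>) *\<^sub>R q + \<theta> *\<^sub>R ?T"
      have q'_eq: "q' = q + \<theta> *\<^sub>R (?T - q)"
        by (simp add: q'_def algebra_simps)
      have "q' \<in> pearl n A' B j"
        unfolding q'_def using \<theta> q touch_pred_in_pearl[OF assms(2,3)] convex_pearl
        by (intro convexD) auto
      moreover have "H q' = H Y"
        using \<theta>(3) by (simp add: HY) (simp add: H_def q'_eq cross2_linear algebra_simps)
      moreover have "cross2 c (Y - x - q') = - \<theta> * (cross2 c ?T - cross2 c q)"
        by (simp add: Yeq q'_eq cross2_linear algebra_simps)
      then have "cross2 c (Y - x - q') \<le> 0"
        using \<theta>(1) cT by (simp add: mult_nonneg_nonpos2)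
      moreover have "j \<in> {n - 1, n}"
        using in_two True h' by linarith
      ultimately show ?thesis
        using finish' by blast
    next
      case F: False
      \<comment> \<open>Here \<open>Y\<close> is higher than pearl \<open>j\<close>, so the point of
        the spine at that height is taken. \<open>cross2 c\<close> grows along the spine, which
        gives the sign condition.\<close>
      define \<xi> where "\<xi> = H Y / cross2 u (B - A')"
      have \<xi>: "0 \<le> \<xi>" "\<xi> \<le> a n + a (n - 1)" "\<xi> * cross2 u (B - A') = H Y"
        using h' w' by (auto simp: \<xi>_def field_simps)
      define q' where "q' = a n *\<^sub>R A' + \<xi> *\<^sub>R (B - A')"
      obtain j' where j': "j' \<in> {n - 1, n}" "q' \<in> pearl n A' B j'"
        using spine_in_pearl[OF assms(2,3) \<xi>(1,2), of A'] unfolding q'_def by blast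
      have T: "?T = a n *\<^sub>R A' + (S n - S (j - 1)) *\<^sub>R (B - A')"
        by (simp add: touch_def algebra_simps)
      have "(S n - S (j - 1)) * cross2 u (B - A') \<le> \<xi> * cross2 u (B - A')"
        using F by (simp add: \<xi>(3) Htouch)
      then have "S n - S (j - 1) \<le> \<xi>"
        using w' by simp
      moreover have "0 \<le> cross2 c (B - A')"
        using c assms(2) by (auto simp: ncone_def)
      ultimately have "(S n - S (j - 1)) * cross2 c (B - A') \<le> \<xi> * cross2 c (B - A')"
        by (rule mult_right_mono)
      then have "cross2 c ?T \<le> cross2 c q'"
        by (simp add: T q'_def cross2.add_right cross2.scaleR_right)
      moreover have "cross2 c (Y - x - q') = cross2 c q - cross2 c q'"
        by (simp add: Yeq cross2_linear)
      ultimately have "cross2 c (Y - x - q') \<le> 0"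
        using cT by linarith
      moreover have "cross2 u (q' - a n *\<^sub>R A') = H Y"
        by (simp add: q'_def cross2.scaleR_right \<xi>(3))
      then have "H q' = H Y"
        by (simp only: H_def)
      ultimately show ?thesis
        using finish' j' by blast
    qed
  qed
qed

section \<open>Widths of \<open>P\<close> and commensurable radii\<close>

lemma ex_ball_in_P:
  obtains x0 \<rho> where "0 < \<rho>" "cball x0 \<rho> \<subseteq> P"
proof -
  obtain x0 where "x0 \<in> interior P" using interior_P by blast
  then show thesis using that by (auto simp: mem_interior_cball)
qed

lemma finite_vertices: "finite {v. v extreme_point_of P}"
  using polytope_P polytope_imp_polyhedron finite_polyhedron_extreme_points by blast

lemma vertex_in_P: "v extreme_point_of P \<Longrightarrow> v \<in> P"
  by (simp add: extreme_point_of_def)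

text \<open>With zero width \<open>cross2 u\<close> would be constant on \<open>P\<close>, but it is
  not constant on a disc inside \<open>P\<close>.\<close>

lemma width_pos:
  assumes "u \<in> ncone P A B" "u \<noteq> 0" "A \<in> P"
  shows "0 < cross2 u (B - A)"
proof (rule ccontr)
  assume "\<not> ?thesis"
  then have "cross2 u (B - A) \<le> 0" by simp
  moreover have "cross2 u (B - A) = cross2 u (B - p) + cross2 u (p - A)" for p
    by (simp add: cross2_linear)
  moreover have "0 \<le> cross2 u (p - A)" "0 \<le> cross2 u (B - p)" if "p \<in> P" for p
    using assms(1) that by (auto simp: ncone_def)
  ultimately have eq: "cross2 u (p - A) = 0" if "p \<in> P" for p
    using that by (smt (verit))
  obtain x0 \<rho> where ball: "0 < \<rho>" "cball x0 \<rho> \<subseteq> P" by (rule ex_ball_in_P)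
  obtain w where w: "norm w = norm u" "cross2 u w = (norm u)\<^sup>2" by (rule ex_cross2_eq_norm)
  define v where "v = (\<rho> / norm u) *\<^sub>R w"
  have "norm v = \<rho>"
    using ball assms(2) by (simp add: v_def w)
  then have "x0 \<in> P" "x0 + v \<in> P"
    using ball by (auto simp: dist_norm)
  then have "cross2 u v = 0"
    using eq[of x0] eq[of "x0 + v"] by (simp add: cross2_linear)
  then show False
    using assms(2) ball by (simp add: v_def cross2.scaleR_right w)
qed

text \<open>Points of the sphere of radius \<open>M\<close> for the width norm \<open>u \<mapsto> max (cross2 u (p - q))\<close>: on its edge
  parallel to \<open>B - A\<close>, those in the direction of a difference of vertices, in particular of a side.\<close>

definition base :: "real \<Rightarrow> real^2 \<Rightarrow> real^2 \<Rightarrow> (real^2) set" where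
  "base M A B = {(M / cross2 (p - q) (B - A)) *\<^sub>R (p - q) | p q.
     p extreme_point_of P \<and> q extreme_point_of P \<and> p \<noteq> q \<and> p - q \<in> ncone P A B}"

lemma base_uminus: "x \<in> base M A B \<Longrightarrow> - x \<in> base M B A"
proof -
  assume "x \<in> base M A B"
  then obtain p q where x: "x = (M / cross2 (p - q) (B - A)) *\<^sub>R (p - q)"
    and pq: "p extreme_point_of P" "q extreme_point_of P" "p \<noteq> q" "p - q \<in> ncone P A B"
    unfolding base_def by blast
  have "cross2 (q - p) (A - B) = cross2 (p - q) (B - A)"
    by (simp add: cross2_def algebra_simps)
  then have "- x = (M / cross2 (q - p) (A - B)) *\<^sub>R (q - p)"
    by (simp add: x algebra_simps)
  moreover have "q - p \<in> ncone P B A"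
    using pq(4) ncone_uminus_iff[of "q - p" P A B] by simp
  ultimately show ?thesis
    unfolding base_def using pq(1-3) by blast
qed

lemma base_cross2:
  assumes "x \<in> base M A B" "A \<in> P"
  shows "cross2 x (B - A) = M"
  using assms width_pos[of _ A B] unfolding base_def by (force simp: cross2.scaleR_left)

lemma ex_vertex_cross2_bound:
  obtains W where "\<And>p q r s. \<lbrakk>p \<in> P; q \<in> P; r \<in> P; s \<in> P\<rbrakk> \<Longrightarrow> \<bar>cross2 (p - q) (r - s)\<bar> \<le> W"
proof -
  obtain b where b: "\<And>p. p \<in> P \<Longrightarrow> norm p \<le> b"
    using compact_P compact_imp_bounded bounded_iff by metis
  have "\<bar>cross2 (p - q) (r - s)\<bar> \<le> 2 * (b + b) * (b + b)" if "p \<in> P" "q \<in> P" "r \<in> P" "s \<in> P" for p q r s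
  proof -
    have "norm (p - q) \<le> b + b" "norm (r - s) \<le> b + b"
      using norm_triangle_ineq4[of p q] norm_triangle_ineq4[of r s] b that by (smt (verit))+
    moreover have "0 \<le> b"
      using b[OF that(1)] norm_ge_zero[of p] by linarith
    ultimately have "2 * norm (p - q) * norm (r - s) \<le> 2 * (b + b) * (b + b)"
      by (intro mult_mono) auto
    with abs_cross2_le[of "p - q" "r - s"] show ?thesis by linarith
  qed
  then show thesis by (rule that)
qed

text \<open>Along one period \<open>2 k\<close> a point moves by \<open>c0 (B - A)\<close>; a commensurable \<open>M\<close> makes the translates
  of the chain to the two ends of an edge coincide.\<close>

definition commensurable :: "real \<Rightarrow> bool" where
  "commensurable M \<longleftrightarrow> (\<forall>A B x y. A extreme_point_of P \<longrightarrow> B extreme_point_of P \<longrightarrow>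
     x \<in> base M A B \<longrightarrow> y \<in> base M A B \<longrightarrow> (\<exists>m::int. x = y + (of_int m * c0) *\<^sub>R (A - B)))"

text \<open>In units of \<kappa> all widths are positive integers below a common bound. The
  difference of two points of \<open>base M A B\<close> is \<open>B - A\<close> times
  \<open>M * m / (\<kappa> * i * j)\<close> up to sign, with widths \<open>i\<close>,
  \<open>j\<close> and an integer \<open>m\<close>, so a factorial clears the denominators.\<close>

lemma ex_commensurable:
  assumes "0 < \<kappa>"
    and lattice: "\<And>p q r s. \<lbrakk>p extreme_point_of P; q extreme_point_of P; r extreme_point_of P; s extreme_point_of P\<rbrakk>
      \<Longrightarrow> \<exists>i::int. cross2 (p - q) (r - s) = \<kappa> * of_int i"
  obtains M where "b < M" "commensurable M"
proof -
  obtain W where W: "\<And>p q r s. \<lbrakk>p \<in> P; q \<in> P; r \<in> P; s \<in> P\<rbrakk> \<Longrightarrow> \<bar>cross2 (p - q) (r - s)\<bar> \<le> W"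
    using ex_vertex_cross2_bound by blast
  define L where "L = nat \<lceil>W / \<kappa>\<rceil>"
  have dvd: "\<exists>i::int. 0 < i \<and> cross2 (p - q) (B - A) = \<kappa> * of_int i \<and> i dvd fact L"
    if "p extreme_point_of P" "q extreme_point_of P" "A extreme_point_of P" "B extreme_point_of P"
      "p \<noteq> q" "p - q \<in> ncone P A B" for p q A B
  proof -
    note V = that
    obtain i :: int where i: "cross2 (p - q) (B - A) = \<kappa> * of_int i"
      using lattice[OF V(1,2,4,3)] by blast
    have "0 < cross2 (p - q) (B - A)"
      using that by (intro width_pos vertex_in_P) auto
    then have "0 < i"
      using i assms(1) by (simp add: zero_less_mult_iff)
    have "\<kappa> * of_int i \<le> W"
      using W[of p q B A] that i vertex_in_P by force
    then have "of_int i \<le> W / \<kappa>"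
      using assms(1) by (simp add: field_simps)
    then have "nat i \<le> L"
      unfolding L_def using \<open>0 < i\<close> by linarith
    then have "nat i dvd fact L"
      using \<open>0 < i\<close> by (intro dvd_fact) auto
    then have "int (nat i) dvd int (fact L)"
      by (simp only: of_nat_dvd_iff)
    then have "i dvd fact L"
      using \<open>0 < i\<close> by simp
    with \<open>0 < i\<close> i show ?thesis by blast
  qed
  \<comment> \<open>The square clears both \<open>i\<close> and \<open>j\<close>, \<kappa> cancels
    the unit and \<open>c0\<close> leaves a multiple of the period of the chain.\<close>
  define M0 where "M0 = \<kappa> * c0 * (fact L)\<^sup>2"
  have "0 < M0"
    using assms(1) c0_pos by (simp add: M0_def)
  then obtain K :: nat where K: "b < real K * M0"
    using ex_less_of_nat_mult by blast
  have "commensurable (real K * M0)"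
    unfolding commensurable_def
  proof (intro allI impI)
    fix A B x y
    assume AB: "A extreme_point_of P" "B extreme_point_of P"
      and x: "x \<in> base (real K * M0) A B" and y: "y \<in> base (real K * M0) A B"
    obtain p q where pq: "p extreme_point_of P" "q extreme_point_of P" "p \<noteq> q" "p - q \<in> ncone P A B"
      and xeq: "x = (real K * M0 / cross2 (p - q) (B - A)) *\<^sub>R (p - q)"
      using x unfolding base_def by blast
    obtain r s where rs: "r extreme_point_of P" "s extreme_point_of P" "r \<noteq> s" "r - s \<in> ncone P A B"
      and yeq: "y = (real K * M0 / cross2 (r - s) (B - A)) *\<^sub>R (r - s)"
      using y unfolding base_def by blast
    obtain i j :: int where i: "0 < i" "cross2 (p - q) (B - A) = \<kappa> * of_int i" "i dvd fact L"
      and j: "0 < j" "cross2 (r - s) (B - A) = \<kappa> * of_int j" "j dvd fact L"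
      using dvd pq rs AB by meson
    obtain i' j' :: int where i': "fact L = i * i'" and j': "fact L = j * j'"
      using i(3) j(3) by (auto elim!: dvdE)
    have i'': "fact L = real_of_int i * real_of_int i'" and j'': "fact L = real_of_int j * real_of_int j'"
      using arg_cong[OF i', of real_of_int] arg_cong[OF j', of real_of_int] by simp_all
    obtain m :: int where m: "cross2 (p - q) (r - s) = \<kappa> * of_int m"
      using lattice[OF pq(1,2) rs(1,2)] by blast
    have "cross2 (B - A) (x - y) = 0"
      using base_cross2[OF x] base_cross2[OF y] AB vertex_in_P cross2_commute[of "B - A"]
      by (simp add: cross2.diff_right)
    moreover have "B - A \<noteq> 0"
      using i assms(1) by (auto simp: cross2.zero_right)
    ultimately obtain t where t: "x - y = t *\<^sub>R (B - A)"
      using cross2_eq_0_imp_scaleR by metis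
    \<comment> \<open>Pairing the difference with \<open>p - q\<close> kills \<open>x\<close> and
      determines the coefficient \<open>t\<close>.\<close>
    have "cross2 (p - q) x = 0" "cross2 (p - q) y = (real K * M0 / (\<kappa> * of_int j)) * (\<kappa> * of_int m)"
      by (simp_all only: xeq yeq cross2.scaleR_right m j cross2_self mult_zero_right real_scaleR_def)
    then have "cross2 (p - q) (x - y) = - (real K * M0 / (\<kappa> * of_int j)) * (\<kappa> * of_int m)"
      by (simp add: cross2.diff_right)
    then have "t * (\<kappa> * of_int i) = - (real K * M0 / (\<kappa> * of_int j)) * (\<kappa> * of_int m)"
      by (simp add: t cross2.scaleR_right i)
    also have "\<dots> = - (real K * c0 * (of_int i * of_int i') * of_int j' * of_int m) * \<kappa>"
      using assms(1) j unfolding M0_def by (simp add: power2_eq_square i''[symmetric]) (simp add: j'')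
    finally have "t * (\<kappa> * of_int i) = - (real K * c0 * of_int i' * of_int j' * of_int m) * (\<kappa> * of_int i)"
      by (simp add: mult_ac)
    then have "t = - (real K * c0 * of_int i' * of_int j' * of_int m)"
      using assms(1) i(1) by (subst (asm) mult_cancel_right) auto
    then have "x = y + (of_int (int K * i' * j' * m) * c0) *\<^sub>R (A - B)"
      using t by (simp add: algebra_simps)
    then show "\<exists>m::int. x = y + (of_int m * c0) *\<^sub>R (A - B)" ..
  qed
  with K that show thesis by blast
qed

text \<open>One radius serves all triples because \<open>P\<close> has finitely many
  vertices.\<close>

lemma ex_common_direction:
  obtains R where "\<And>A A' B Y. \<lbrakk>A extreme_point_of P; A' extreme_point_of P; B extreme_point_of P;
      Y \<in> approx_ncone \<kappa> P A A' B; R < norm Y\<rbrakk>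
    \<Longrightarrow> \<exists>u. u \<noteq> 0 \<and> u \<in> ncone P A B \<and> u \<in> ncone P A' B"
proof -
  let ?V = "{v. v extreme_point_of P}"
  have "\<exists>R. \<forall>Y\<in>approx_ncone \<kappa> P A A' B. R < norm Y \<longrightarrow>
      (\<exists>u. u \<noteq> 0 \<and> u \<in> ncone P A B \<and> u \<in> ncone P A' B)" for A A' B
    using approx_ncone_unbounded_imp[of \<kappa> P A A' B] by blast
  then obtain R where R: "\<And>A A' B Y. Y \<in> approx_ncone \<kappa> P A A' B \<Longrightarrow> R A A' B < norm Y \<Longrightarrow>
      \<exists>u. u \<noteq> 0 \<and> u \<in> ncone P A B \<and> u \<in> ncone P A' B"
    by metis
  define T where "T = (\<lambda>(A, A', B). R A A' B) ` (?V \<times> ?V \<times> ?V)"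
  have "finite T"
    unfolding T_def using finite_vertices by blast
  then have le: "R A A' B \<le> Max T"
    if "A extreme_point_of P" "A' extreme_point_of P" "B extreme_point_of P" for A A' B
    using that by (intro Max_ge) (auto simp: T_def image_iff)
  show thesis
    by (rule that[of "Max T"], rule R) (use le in \<open>auto intro: order_le_less_trans\<close>)
qed

end

section \<open>Scaled orbits and the necklace as a barrier\<close>

locale refractive_orbit = refractive_table +
  fixes Y A :: "int \<Rightarrow> real^2"
  assumes vertex: "A n extreme_point_of P"
    and step: "Y n + Y (n - 1) = (a n + a (n - 1)) *\<^sub>R A n"
    and head: "p \<in> P \<Longrightarrow> 0 \<le> cross2 (Y (n - 1) - a (n - 1) *\<^sub>R A n) (p - A n)"
    and off_sides: "\<not> on_side_line P (Y n /\<^sub>R a n)"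
begin

lemma A_in_P: "A n \<in> P"
  by (rule vertex_in_P[OF vertex])

lemma Y_Suc: "Y (n + 1) = (a (n + 1) + a n) *\<^sub>R A (n + 1) - Y n"
  using step[of "n + 1"] by (simp add: algebra_simps)

lemma Y_Suc_Suc:
  "Y (n + 1) = (a (n + 1) + a n) *\<^sub>R A (n + 1) - (a n + a (n - 1)) *\<^sub>R A n + Y (n - 1)"
proof -
  have "Y n = (a n + a (n - 1)) *\<^sub>R A n - Y (n - 1)"
    using step[of n] by (simp add: algebra_simps)
  then show ?thesis
    by (simp add: Y_Suc)
qed

lemma head_Suc: "p \<in> P \<Longrightarrow> 0 \<le> cross2 (Y n - a n *\<^sub>R A (n + 1)) (p - A (n + 1))"
  using head[of p "n + 1"] by simp

text \<open>By \<open>step\<close>, the scaled contact vertex sees the two consecutive points in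
  opposite directions, so a head inequality becomes a tail inequality.\<close>

lemma tail:
  assumes "p \<in> P"
  shows "0 \<le> cross2 (Y n - a n *\<^sub>R A n) (A n - p)"
proof -
  have "Y n - a n *\<^sub>R A n = - (Y (n - 1) - a (n - 1) *\<^sub>R A n)"
    using step[of n] by (simp add: algebra_simps)
  then have "cross2 (Y n - a n *\<^sub>R A n) (A n - p) = cross2 (Y (n - 1) - a (n - 1) *\<^sub>R A n) (p - A n)"
    by (simp only:) (simp add: cross2_def algebra_simps)
  with head[OF assms, of n] show ?thesis by simp
qed

text \<open>\<open>energy n\<close> is, up to a factor, the area of the triangle spanned by the current point and
  the two contact vertices.\<close>

definition energy :: "int \<Rightarrow> real" where
  "energy n = cross2 (Y n - a n *\<^sub>R A (n + 1)) (A n - A (n + 1))"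

text \<open>The step negates the vector from the contact vertex up to a multiple of
  \<open>A n - A (n + 1)\<close>, which the cross product kills.\<close>

lemma energy_eq_if_same_vertex:
  assumes "A (n + 2) = A n"
  shows "energy (n + 1) = energy n"
proof -
  have "A (n + 1 + 1) = A n"
    using assms by (simp add: add.assoc)
  then show ?thesis
    unfolding energy_def Y_Suc by (simp only:) (simp add: cross2_def algebra_simps)
qed

text \<open>Both head vertices minimise \<open>cross2 u\<close>, so they lie on one side, parallel
  to \<open>u\<close>. The height above it grows by a fixed positive amount in two steps; with the
  two head inequalities this orients \<open>v\<close> and puts the point just beyond the
  ray.\<close>

lemma crossing:
  assumes "A (n + 2) \<noteq> A n"
    and "u \<noteq> 0" "u \<in> ncone P (A n) (A (n + 1))" "u \<in> ncone P (A (n + 2)) (A (n + 1))"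
  defines "v \<equiv> A (n + 2) - A n"
  shows "v \<in> ncone P (A n) (A (n + 1))"
    and "0 < cross2 v (Y (n + 1) - a (n + 1) *\<^sub>R A (n + 2))"
    and "cross2 v (Y (n + 1) - a (n + 1) *\<^sub>R A (n + 2)) < (a (n + 1) + a n) * cross2 v (A (n + 1) - A n)"
proof -
  let ?A = "A n" and ?B = "A (n + 1)" and ?A' = "A (n + 2)" and ?N = "n + 1"
  have "0 \<le> cross2 u (?A' - ?A)" "0 \<le> cross2 u (?A - ?A')"
    using assms(3,4) A_in_P by (auto simp: ncone_def)
  then have "cross2 u (?A' - ?A) = 0"
    by (simp add: cross2_linear)
  then obtain \<mu> where \<mu>: "?A' - ?A = \<mu> *\<^sub>R u"
    using cross2_eq_0_imp_scaleR assms(2) by metis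
  have "\<mu> \<noteq> 0" using \<mu> assms(1) by auto
  \<comment> \<open>\<open>y1\<close> and \<open>y2\<close> are the heights at the times
    \<open>n + 1\<close> and \<open>n - 1\<close>; the head inequalities fix their signs relative to
    \<open>\<mu>\<close>.\<close>
  define y1 where "y1 = cross2 u (Y ?N - a ?N *\<^sub>R ?A')"
  define y2 where "y2 = cross2 u (Y (n - 1) - a (n - 1) *\<^sub>R ?A)"
  define w where "w = cross2 u (?B - ?A)"
  have w: "0 < w"
    unfolding w_def using assms(2,3) A_in_P by (intro width_pos)
  have "0 \<le> cross2 (Y ?N - a ?N *\<^sub>R ?A') (?A - ?A')"
    using head_Suc[OF A_in_P[of n], of ?N] by (simp add: add.assoc)
  moreover have "?A - ?A' = - (\<mu> *\<^sub>R u)"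
    using \<mu> by (simp add: algebra_simps)
  ultimately have "0 \<le> \<mu> * y1"
    using cross2_commute[of u] by (simp add: y1_def cross2.scaleR_right cross2.minus_right)
  have "0 \<le> cross2 (Y (n - 1) - a (n - 1) *\<^sub>R ?A) (?A' - ?A)"
    by (rule head[OF A_in_P])
  then have "\<mu> * y2 \<le> 0"
    using cross2_commute[of u] by (simp add: y2_def \<mu> cross2.scaleR_right)
  have supp: "0 \<le> cross2 u (p - ?A)" "0 \<le> cross2 u (p - ?A')" if "p \<in> P" for p
    using assms(3,4) that by (auto simp: ncone_def)
  \<comment> \<open>Height zero would put an orbit point on the line through a side; this makes the
    inequalities strict.\<close>
  have nz: "cross2 u (Y m - a m *\<^sub>R ?A) \<noteq> 0" for m
  proof
    assume "cross2 u (Y m - a m *\<^sub>R ?A) = 0"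
    moreover have "Y m /\<^sub>R a m - ?A = (Y m - a m *\<^sub>R ?A) /\<^sub>R a m"
      using a_pos[of m] by (simp add: algebra_simps)
    ultimately have "cross2 u (Y m /\<^sub>R a m - ?A) = 0"
      by (simp add: cross2.scaleR_right)
    then have "on_side_line P (Y m /\<^sub>R a m)"
      using assms(1,2) \<open>cross2 u (?A' - ?A) = 0\<close> supp A_in_P convex_P
      by (intro on_side_line_if_supporting[of P ?A ?A' u]) auto
    with off_sides show False by blast
  qed
  have y1_eq: "y1 = cross2 u (Y ?N - a ?N *\<^sub>R ?A)"
    using \<open>cross2 u (?A' - ?A) = 0\<close> by (simp add: y1_def cross2_linear)
  have "Y ?N - a ?N *\<^sub>R ?A = (a ?N + a n) *\<^sub>R (?B - ?A) + (Y (n - 1) - a (n - 1) *\<^sub>R ?A)"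
    unfolding Y_Suc_Suc by (simp add: algebra_simps)
  then have rel: "y1 = (a ?N + a n) * w + y2"
    unfolding y1_eq y2_def w_def by (simp only: cross2.add_right cross2.scaleR_right real_scaleR_def)
  have pos: "0 < (a ?N + a n) * w"
    using w a_pos[of ?N] a_pos[of n] by simp
  have "y1 \<noteq> 0" "y2 \<noteq> 0"
    using nz by (auto simp: y1_eq y2_def)
  have "0 < \<mu>"
  proof (rule ccontr)
    assume "\<not> 0 < \<mu>"
    then have "\<mu> < 0" using \<open>\<mu> \<noteq> 0\<close> by simp
    then have "y1 \<le> 0" "0 \<le> y2"
      using \<open>0 \<le> \<mu> * y1\<close> \<open>\<mu> * y2 \<le> 0\<close> by (auto simp: zero_le_mult_iff mult_le_0_iff)
    with rel pos show False by linarith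
  qed
  then have "0 < y1" "y2 < 0"
    using \<open>0 \<le> \<mu> * y1\<close> \<open>\<mu> * y2 \<le> 0\<close> \<open>y1 \<noteq> 0\<close> \<open>y2 \<noteq> 0\<close>
    by (auto simp: zero_le_mult_iff mult_le_0_iff)
  have v: "v = \<mu> *\<^sub>R u" using \<mu> by (simp add: v_def)
  show "v \<in> ncone P ?A ?B"
    unfolding v using \<open>0 < \<mu>\<close> assms(3) by (intro ncone_scaleR) auto
  show "0 < cross2 v (Y ?N - a ?N *\<^sub>R ?A')"
    using \<open>0 < \<mu>\<close> \<open>0 < y1\<close> by (simp add: v cross2.scaleR_left y1_def[symmetric])
  have "\<mu> * y1 < \<mu> * ((a ?N + a n) * w)"
    using \<open>0 < \<mu>\<close> \<open>y2 < 0\<close> rel by (intro mult_strict_left_mono) auto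
  then show "cross2 v (Y ?N - a ?N *\<^sub>R ?A') < (a ?N + a n) * cross2 v (?B - ?A)"
    by (simp add: v cross2.scaleR_left y1_def[symmetric] w_def[symmetric] mult.left_commute)
qed

text \<open>Two steps move the scaled point by a bounded vector, so the head inequality at time
  \<open>n - 1\<close> also holds approximately at time \<open>n + 1\<close>, next to the head and
  tail inequalities there.\<close>

lemma far_crossing:
  obtains R where "\<And>n. A (n + 2) \<noteq> A n \<Longrightarrow> R < norm (Y (n + 1)) \<Longrightarrow>
    \<exists>u. u \<noteq> 0 \<and> u \<in> ncone P (A n) (A (n + 1)) \<and> u \<in> ncone P (A (n + 2)) (A (n + 1))"
proof -
  obtain b where b: "\<And>p. p \<in> P \<Longrightarrow> norm p \<le> b"
    using compact_P compact_imp_bounded bounded_iff by metis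
  define c where "c = Max (range a)"
  have c: "a j \<le> c" for j
    unfolding c_def using finite_range_a by simp
  have "0 \<le> b" using b[OF A_in_P[of 0]] norm_ge_zero order_trans by blast
  have ab: "norm (a j *\<^sub>R A i) \<le> c * b" for i j
    using c[of j] b[OF A_in_P[of i]] a_pos[of j] by (simp add: mult_mono)
  have "0 \<le> c * b" using ab norm_ge_zero order_trans by blast
  obtain R where R: "\<And>A A' B Y. \<lbrakk>A extreme_point_of P; A' extreme_point_of P; B extreme_point_of P;
      Y \<in> approx_ncone (3 * (c * b)) P A A' B; R < norm Y\<rbrakk>
    \<Longrightarrow> \<exists>u. u \<noteq> 0 \<and> u \<in> ncone P A B \<and> u \<in> ncone P A' B"
    using ex_common_direction by blast
  have "Y (n + 1) \<in> approx_ncone (3 * (c * b)) P (A n) (A (n + 2)) (A (n + 1))" for n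
  proof -
    let ?A = "A n" and ?B = "A (n + 1)" and ?A' = "A (n + 2)" and ?N = "n + 1"
    \<comment> \<open>Chosen so that \<open>Y ?N - v1\<close> is the vector in the head inequality
      at time \<open>n - 1\<close>.\<close>
    define v1 where "v1 = a ?N *\<^sub>R ?B + a n *\<^sub>R ?B - a n *\<^sub>R ?A"
    have "norm v1 \<le> norm (a ?N *\<^sub>R ?B) + norm (a n *\<^sub>R ?B) + norm (a n *\<^sub>R ?A)"
      unfolding v1_def using norm_triangle_ineq norm_triangle_ineq4 by (smt (verit))
    then have "norm v1 \<le> 3 * (c * b)"
      using ab[of ?N ?N] ab[of n ?N] ab[of n n] by linarith
    moreover have "norm (a ?N *\<^sub>R ?A') \<le> 3 * (c * b)" "norm (a ?N *\<^sub>R ?B) \<le> 3 * (c * b)"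
      using ab[of ?N "n + 2"] ab[of ?N ?N] \<open>0 \<le> c * b\<close> by linarith+
    moreover have "Y ?N - v1 = Y (n - 1) - a (n - 1) *\<^sub>R ?A"
      unfolding Y_Suc_Suc v1_def by (simp add: algebra_simps)
    ultimately show ?thesis
      unfolding approx_ncone_def using head[of _ n] head_Suc[of _ ?N] tail[of _ ?N]
      by (intro CollectI exI[of _ v1] exI[of _ "a ?N *\<^sub>R ?A'"] exI[of _ "a ?N *\<^sub>R ?B"])
         (auto simp: add.assoc)
  qed
  then show thesis
    using that[of R] R vertex by blast
qed

text \<open>Up to a bounded error the energy is the width of \<open>P\<close> across
  \<open>Y n\<close>, which is at least \<open>\<rho> * norm (Y n)\<close> because \<open>P\<close>
  contains a disc of radius \<rho>.\<close>

lemma bounded_if_energy_le: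
  assumes "\<And>n. n \<in> N \<Longrightarrow> energy n \<le> M"
  shows "bounded (Y ` N)"
proof -
  obtain b where b: "\<And>p. p \<in> P \<Longrightarrow> norm p \<le> b"
    using compact_P compact_imp_bounded bounded_iff by metis
  define c where "c = Max (range a)"
  have c: "a j \<le> c" for j
    unfolding c_def using finite_range_a by simp
  obtain x0 \<rho> where ball: "0 < \<rho>" "cball x0 \<rho> \<subseteq> P" by (rule ex_ball_in_P)
  define C where "C = c * (2 * b * (2 * b))"
  have "0 \<le> b" using b[OF A_in_P[of 0]] norm_ge_zero order_trans by blast
  have C: "\<bar>a n * cross2 p (q - r)\<bar> \<le> C" if "p \<in> P" "q \<in> P" "r \<in> P" for n p q r
  proof -
    have "norm (q - r) \<le> 2 * b"
      using norm_triangle_ineq4[of q r] b[OF that(2)] b[OF that(3)] by linarith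
    then have "2 * norm p * norm (q - r) \<le> 2 * b * (2 * b)"
      using b[OF that(1)] \<open>0 \<le> b\<close> by (intro mult_mono) auto
    with abs_cross2_le[of p "q - r"] have "\<bar>cross2 p (q - r)\<bar> \<le> 2 * b * (2 * b)"
      by linarith
    then show ?thesis
      unfolding C_def abs_mult using c[of n] a_pos[of n] by (intro mult_mono) auto
  qed
  have "norm (Y n) \<le> (M + 3 * C) / \<rho>" if "n \<in> N" for n
  proof (cases "Y n = 0")
    case False
    obtain w where w: "norm w = norm (Y n)" "cross2 (Y n) w = (norm (Y n))\<^sup>2"
      by (rule ex_cross2_eq_norm)
    define v where "v = (\<rho> / norm (Y n)) *\<^sub>R w"
    have "norm v = \<rho>"
      using ball False by (simp add: v_def w)
    then have P: "x0 \<in> P" "x0 + v \<in> P"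
      using ball by (auto simp: dist_norm)
    let ?A = "A (n + 1)" and ?B = "A n"
    have "cross2 (Y n) v = cross2 (Y n) (?B - ?A) - cross2 (Y n) (x0 - ?A) - cross2 (Y n) (?B - (x0 + v))"
      by (simp add: cross2.add_right cross2.diff_right)
    also have "\<dots> = energy n + a n * cross2 ?A (?B - ?A)
        - (cross2 (Y n - a n *\<^sub>R ?A) (x0 - ?A) + a n * cross2 ?A (x0 - ?A))
        - (cross2 (Y n - a n *\<^sub>R ?B) (?B - (x0 + v)) + a n * cross2 ?B (?B - (x0 + v)))"
      by (simp add: energy_def cross2.diff_left cross2.scaleR_left)
    also have "\<dots> \<le> M + 3 * C"
      using assms[OF that] head_Suc[OF P(1), of n] tail[OF P(2), of n]
        C[OF A_in_P A_in_P A_in_P, of n "n + 1" n "n + 1"]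
        C[OF A_in_P P(1) A_in_P, of n "n + 1" "n + 1"] C[OF A_in_P A_in_P P(2), of n n n]
      by linarith
    finally have "cross2 (Y n) v \<le> M + 3 * C" .
    moreover have "cross2 (Y n) v = \<rho> * norm (Y n)"
      using False by (simp add: v_def cross2.scaleR_right w power2_eq_square)
    ultimately show ?thesis
      using ball(1) by (simp add: field_simps)
  next
    case True
    have "0 \<le> energy n"
      unfolding energy_def by (rule head_Suc[OF A_in_P])
    moreover have "0 \<le> C"
      using C[OF A_in_P A_in_P A_in_P] abs_ge_zero order_trans by blast
    ultimately have "0 \<le> M + 3 * C"
      using assms[OF that] by linarith
    then show ?thesis
      using True ball(1) by simp
  qed
  then show ?thesis
    unfolding bounded_iff by blast
qed

text \<open>The invariant of the inner side. The energy changes only when the head vertex does, and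
  its bound is then recovered from the second clause.\<close>

definition enclosed :: "real \<Rightarrow> int \<Rightarrow> bool" where
  "enclosed M n \<longleftrightarrow> energy n \<le> M \<and>
     (\<forall>x\<in>base M (A (n + 1)) (A n). Y n \<notin> outer n (A (n + 1)) (A n) x)"

text \<open>While the vertices alternate, the reflection carries the invariant along. At a crossing,
  commensurability moves every chain on the new edge to the corner shared with the old edge, where
  \<open>outer_across_ray\<close> leads back to the old chain.\<close>

lemma enclosed_step:
  assumes "commensurable M" and "enclosed M n"
    and u: "A (n + 2) \<noteq> A n \<Longrightarrow>
      \<exists>u. u \<noteq> 0 \<and> u \<in> ncone P (A n) (A (n + 1)) \<and> u \<in> ncone P (A (n + 2)) (A (n + 1))"
  shows "enclosed M (n + 1)"
proof -
  let ?A = "A n" and ?B = "A (n + 1)" and ?A' = "A (n + 2)" and ?N = "n + 1"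
  have not_old: "Y ?N \<notin> outer ?N ?A ?B x" if "x \<in> base M ?A ?B" for x
  proof
    assume "Y ?N \<in> outer ?N ?A ?B x"
    from outer_reflect[OF this] have "Y n \<in> outer n ?B ?A (- x)"
      by (simp add: Y_Suc)
    moreover have "- x \<in> base M ?B ?A"
      using that by (rule base_uminus)
    ultimately show False
      using assms(2) by (auto simp: enclosed_def)
  qed
  have two: "A (?N + 1) = ?A'" by (simp add: add.assoc)
  show ?thesis
  proof (cases "?A' = ?A")
    case True
    then show ?thesis
      using assms(2) not_old energy_eq_if_same_vertex[OF True]
      unfolding enclosed_def two True by auto
  next
    case False
    define v where "v = ?A' - ?A"
    obtain u where u: "u \<noteq> 0" "u \<in> ncone P ?A ?B" "u \<in> ncone P ?A' ?B"
      using u[OF False] by blast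
    note cr = crossing[OF False u, folded v_def]
    have "v \<noteq> 0" using False by (simp add: v_def)
    have w: "0 < cross2 v (?B - ?A)"
      using cr(1) \<open>v \<noteq> 0\<close> A_in_P by (rule width_pos)
    have swap: "cross2 v (p - ?A') = cross2 v (p - ?A)" for p
      by (simp add: v_def cross2_def algebra_simps)
    have vA': "v \<in> ncone P ?A' ?B"
      using cr(1) by (simp add: ncone_def swap)
    \<comment> \<open>\<open>s *\<^sub>R v\<close> is the common corner of the two edges of the
      sphere of radius \<open>M\<close>, hence in both bases.\<close>
    define s where "s = M / cross2 v (?B - ?A)"
    have s': "s = M / cross2 v (?B - ?A')"
      by (simp add: s_def swap)
    have base: "s *\<^sub>R v \<in> base M ?A ?B"
      using cr(1) vertex False unfolding base_def s_def v_def by blast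
    have base': "s *\<^sub>R v \<in> base M ?A' ?B"
      using vA' vertex False unfolding base_def s' v_def by blast
    have not_outer: "Y ?N \<notin> outer ?N ?A' ?B x" if x: "x \<in> base M ?A' ?B" for x
    proof
      assume "Y ?N \<in> outer ?N ?A' ?B x"
      moreover obtain m :: int where "x = s *\<^sub>R v + (of_int m * c0) *\<^sub>R (?A' - ?B)"
        using assms(1) vertex[of "n + 2"] vertex[of "n + 1"] x base' unfolding commensurable_def by blast
      ultimately have "Y ?N \<in> outer ?N ?A' ?B (s *\<^sub>R v + (of_int m * c0) *\<^sub>R (?A' - ?B))"
        by simp
      then have "Y ?N \<in> outer ?N ?A' ?B (s *\<^sub>R v)"
        by (rule outer_shift)
      from outer_across_ray[OF A_in_P[of n] A_in_P A_in_P _ _ _ this, folded v_def, OF cr(1) w refl cr(2)]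
      have "Y ?N \<in> outer ?N ?A ?B (s *\<^sub>R v)"
        using cr(3) by simp
      with not_old[OF base] show False ..
    qed
    \<comment> \<open>\<open>q\<close> is the spine point at the height of the orbit point, and
      \<open>\<nu>\<close> tells how far along \<open>v\<close> the orbit point lies beyond the
      translate of \<open>q\<close> to the corner. If \<open>\<nu>\<close> is nonnegative the point
      is outer; if negative, the energy is below \<open>M\<close>.\<close>
    define \<xi> where "\<xi> = cross2 v (Y ?N - a ?N *\<^sub>R ?A') / cross2 v (?B - ?A)"
    have \<xi>: "0 \<le> \<xi>" "\<xi> \<le> a ?N + a n" "\<xi> * cross2 v (?B - ?A) = cross2 v (Y ?N - a ?N *\<^sub>R ?A')"
      using cr(2,3) w by (auto simp: \<xi>_def field_simps)
    define q where "q = a ?N *\<^sub>R ?A' + \<xi> *\<^sub>R (?B - ?A')"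
    have "cross2 v (Y ?N - s *\<^sub>R v - q) = 0"
      using \<xi>(3) swap[of ?B] by (simp add: q_def cross2.diff_right cross2.add_right cross2.scaleR_right)
    then obtain \<nu> where \<nu>: "Y ?N - s *\<^sub>R v - q = \<nu> *\<^sub>R v"
      using cross2_eq_0_imp_scaleR \<open>v \<noteq> 0\<close> by metis
    have "\<nu> < 0"
    proof (rule ccontr)
      assume "\<not> \<nu> < 0"
      then have "\<nu> *\<^sub>R v \<in> ncone P ?A ?B"
        using cr(1) by (intro ncone_scaleR) auto
      moreover obtain j where "q \<in> pearl ?N ?A ?B j"
        using spine_in_pearl[of ?A' ?B \<xi> ?N ?A] A_in_P \<xi>(1,2) by (auto simp: q_def)
      moreover have "Y ?N = s *\<^sub>R v + q + \<nu> *\<^sub>R v"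
        using \<nu> by (simp add: algebra_simps)
      ultimately have "Y ?N \<in> outer ?N ?A ?B (s *\<^sub>R v)"
        unfolding outer_def by blast
      with not_old[OF base] show False ..
    qed
    have "Y ?N - a ?N *\<^sub>R ?A' = (s + \<nu>) *\<^sub>R v + \<xi> *\<^sub>R (?B - ?A')"
      using \<nu> by (simp add: q_def algebra_simps)
    then have "energy ?N = (s + \<nu>) * cross2 v (?B - ?A)"
      unfolding energy_def two by (simp add: cross2.add_left cross2.scaleR_left swap)
    also have "\<dots> = M + \<nu> * cross2 v (?B - ?A)"
      using w by (simp add: s_def distrib_right)
    also have "\<dots> \<le> M"
      using \<open>\<nu> < 0\<close> w by (simp add: mult_le_0_iff)
    finally show ?thesis
      using not_outer unfolding enclosed_def two by blast
  qed
qed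

text \<open>Outside a disc the invariant propagates by \<open>enclosed_step\<close>. Inside it
  \<open>far_crossing\<close> says nothing, but there the energy is so low that the invariant holds
  anyway.\<close>

lemma bounded_forward:
  assumes "0 < \<kappa>"
    and lattice: "\<And>p q r s. \<lbrakk>p extreme_point_of P; q extreme_point_of P; r extreme_point_of P; s extreme_point_of P\<rbrakk>
      \<Longrightarrow> \<exists>i::int. cross2 (p - q) (r - s) = \<kappa> * of_int i"
  shows "bounded (Y ` {0..})"
proof -
  define c where "c = Max (range a)"
  have c: "a j \<le> c" for j
    unfolding c_def using finite_range_a by simp
  obtain b where b: "\<And>p. p \<in> P \<Longrightarrow> norm p \<le> b"
    using compact_P compact_imp_bounded bounded_iff by metis
  obtain W where W: "\<And>p q r s. \<lbrakk>p \<in> P; q \<in> P; r \<in> P; s \<in> P\<rbrakk> \<Longrightarrow> \<bar>cross2 (p - q) (r - s)\<bar> \<le> W"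
    using ex_vertex_cross2_bound by blast
  obtain R where R: "\<And>n. A (n + 2) \<noteq> A n \<Longrightarrow> R < norm (Y (n + 1)) \<Longrightarrow>
    \<exists>u. u \<noteq> 0 \<and> u \<in> ncone P (A n) (A (n + 1)) \<and> u \<in> ncone P (A (n + 2)) (A (n + 1))"
    using far_crossing by blast
  define K where "K = 2 * (R + c * b) * (b + b)"
  have near: "energy n \<le> K" if "norm (Y n) \<le> R" for n
  proof -
    have "0 \<le> R" "0 \<le> b" "0 \<le> c"
      using that b[OF A_in_P[of 0]] a_pos[of 0] c[of 0]
      by (auto intro: order_trans[OF norm_ge_zero])
    have "norm (a n *\<^sub>R A (n + 1)) \<le> c * b"
      using c[of n] b[OF A_in_P[of "n + 1"]] a_pos[of n] by (simp add: mult_mono)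
    then have "norm (Y n - a n *\<^sub>R A (n + 1)) \<le> R + c * b"
      using that norm_triangle_ineq4[of "Y n" "a n *\<^sub>R A (n + 1)"] by linarith
    moreover have "norm (A n - A (n + 1)) \<le> b + b"
      using norm_triangle_ineq4[of "A n" "A (n + 1)"] b[OF A_in_P[of n]] b[OF A_in_P[of "n + 1"]]
      by linarith
    ultimately have "2 * norm (Y n - a n *\<^sub>R A (n + 1)) * norm (A n - A (n + 1)) \<le> K"
      unfolding K_def using \<open>0 \<le> R\<close> \<open>0 \<le> b\<close> \<open>0 \<le> c\<close> by (intro mult_mono) auto
    with abs_cross2_le[of "Y n - a n *\<^sub>R A (n + 1)" "A n - A (n + 1)"] show ?thesis
      by (simp add: energy_def)
  qed
  \<comment> \<open>The margin \<open>\<bar>c * W\<bar>\<close> allows for the thickness of the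
    pearls, so that points of low energy cannot be outer.\<close>
  obtain M where M: "max K (energy 0) + \<bar>c * W\<bar> < M" "commensurable M"
    using ex_commensurable[OF assms] by blast
  have low: "enclosed M n" if "energy n \<le> max K (energy 0)" for n
  proof -
    have "False" if "x \<in> base M (A (n + 1)) (A n)" "Y n \<in> outer n (A (n + 1)) (A n) x" for x
    proof -
      have "cross2 x (A n - A (n + 1)) - c * W \<le> energy n"
        unfolding energy_def
        by (rule outer_cross2_ge[OF that(2) A_in_P A_in_P]) (auto intro: W c A_in_P)
      then show False
        using base_cross2[OF that(1) A_in_P] \<open>energy n \<le> max K (energy 0)\<close> M(1) by linarith
    qed
    then show ?thesis
      using that M(1) unfolding enclosed_def by force
  qed
  have "enclosed M n" if "0 \<le> n" for n
    using that
  proof (induction n rule: int_ge_induct)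
    case base
    show ?case by (rule low) simp
  next
    case (step n)
    show ?case
    proof (cases "norm (Y (n + 1)) \<le> R")
      case True
      then show ?thesis using near low by fastforce
    next
      case False
      then show ?thesis
        using enclosed_step[OF M(2), of n] step.IH R[of n] unfolding enclosed_def by fastforce
    qed
  qed
  then show ?thesis
    by (intro bounded_if_energy_le[of _ M]) (auto simp: enclosed_def)
qed

end

section \<open>Orbits of the billiard map\<close>

text \<open>The vectors from \<open>z\<close> and \<open>z'\<close> to \<open>B\<close> are
  opposite, so \<open>P\<close> changes sides.\<close>

lemma head_eq_iff_tail_eq:
  assumes "compact P" "convex P" "P \<noteq> {}" "0 < l"
    and "z \<notin> P" "\<not> on_side_line P z" "z' \<notin> P" "\<not> on_side_line P z'"
    and z': "z' = refl_scale B l z"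
  shows "head P z = B \<longleftrightarrow> tail P z' = B"
proof -
  have "cross2 (B - z') (p - z') = - l * cross2 (B - z) (p - z)" for p
    by (simp add: z' refl_scale_def cross2_def algebra_simps)
  then have "0 \<le> cross2 (B - z') (p - z') \<longleftrightarrow> cross2 (B - z) (p - z) \<le> 0" for p
    using \<open>0 < l\<close> by (simp add: mult_le_0_iff)
  then show ?thesis
    using assms by (simp add: head_eq_iff tail_eq_iff)
qed

lemma refl_scale_inverse: "l \<noteq> 0 \<Longrightarrow> refl_scale B (1 / l) (refl_scale B l z) = z"
  by (simp add: refl_scale_def)

lemma refr_index_periodic: "refr_index k l (m + int k * j) = refr_index k l m"
proof -
  have "m + int k * j - 1 = (m - 1) + int k * j" by simp
  then show ?thesis by (simp only: refr_index_def mod_mult_self2)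
qed

lemma billiard_orbit_Suc:
  "0 \<le> m \<Longrightarrow> billiard_orbit P k l z (m + 1) =
     Option.bind (billiard_orbit P k l z m) (forward_step P (refr_index k l (m + 1)))"
  by (simp add: billiard_orbit_def nat_add_distrib add.commute)

lemma billiard_orbit_pred:
  assumes "m \<le> 0"
  shows "billiard_orbit P k l z (m - 1) =
     Option.bind (billiard_orbit P k l z m) (backward_step P (refr_index k l m))"
proof -
  have "nat (- (m - 1)) = Suc (nat (- m))"
    using assms by simp
  then show ?thesis
    using assms by (cases "m = 0") (simp_all add: billiard_orbit_def)
qed

text \<open>The orbit is built with heads after time zero and with tails before it. As the head
  about a point is the tail about its image, both recursions hold at all times.\<close>

lemma strongly_regular_orbit:
  assumes "compact P" "convex P" "P \<noteq> {}" "strongly_regular P k l z"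
    and l: "\<And>m. 0 < refr_index k l m"
  obtains w where "\<And>m. billiard_orbit P k l z m = Some (w m)"
    and "\<And>m. w m \<notin> P" "\<And>m. \<not> on_side_line P (w m)"
    and "\<And>m. w m = refl_scale (head P (w (m - 1))) (refr_index k l m) (w (m - 1))"
    and "\<And>m. w (m - 1) = refl_scale (tail P (w m)) (1 / refr_index k l m) (w m)"
proof -
  obtain w where w: "\<And>m. billiard_orbit P k l z m = Some (w m)" and off: "\<And>m. \<not> on_side_line P (w m)"
    using assms(4) unfolding strongly_regular_def by metis
  have fwd: "w m \<notin> P \<and> w (m + 1) = refl_scale (head P (w m)) (refr_index k l (m + 1)) (w m)" if "0 \<le> m" for m
    using billiard_orbit_Suc[OF that, of P k l z] by (auto simp: w forward_step_def split: if_splits)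
  have bwd: "w m \<notin> P \<and> w (m - 1) = refl_scale (tail P (w m)) (1 / refr_index k l m) (w m)" if "m \<le> 0" for m
    using billiard_orbit_pred[OF that, of P k l z] by (auto simp: w backward_step_def split: if_splits)
  have out: "w m \<notin> P" for m
    using fwd[of m] bwd[of m] by linarith
  have both: "w m = refl_scale (head P (w (m - 1))) (refr_index k l m) (w (m - 1)) \<and>
      w (m - 1) = refl_scale (tail P (w m)) (1 / refr_index k l m) (w m)" for m
  proof (cases "1 \<le> m")
    case True
    then have f: "w m = refl_scale (head P (w (m - 1))) (refr_index k l m) (w (m - 1))"
      using fwd[of "m - 1"] by simp
    then have "tail P (w m) = head P (w (m - 1))"
      using head_eq_iff_tail_eq[OF assms(1-3) l out off out off f] by simp
    moreover have "w (m - 1) = refl_scale (head P (w (m - 1))) (1 / refr_index k l m) (w m)"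
      using refl_scale_inverse[of "refr_index k l m" "head P (w (m - 1))" "w (m - 1)"] f l[of m] by simp
    ultimately show ?thesis using f by simp
  next
    case False
    then have b: "w (m - 1) = refl_scale (tail P (w m)) (1 / refr_index k l m) (w m)"
      using bwd[of m] by simp
    then have f: "w m = refl_scale (tail P (w m)) (refr_index k l m) (w (m - 1))"
      using refl_scale_inverse[of "1 / refr_index k l m" "tail P (w m)" "w m"] l[of m] by simp
    then have "head P (w (m - 1)) = tail P (w m)"
      using head_eq_iff_tail_eq[OF assms(1-3) l out off out off f] by simp
    then show ?thesis using f b by simp
  qed
  show thesis
    using w out off both by (intro that[of w]) blast+
qed

text \<open>The head recursion spreads a coincidence forwards and the tail recursion backwards;
  equal residues modulo \<open>k\<close> make the refractive indices agree.\<close>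

lemma periodic_orbit_if_recurrent:
  assumes "compact P" "convex P" "P \<noteq> {}" "strongly_regular P k l z"
    and l: "\<And>m. 0 < refr_index k l m"
    and "m < m'" "m mod int k = m' mod int k"
    and eq: "billiard_orbit P k l z m = billiard_orbit P k l z m'"
  shows "periodic_orbit P k l z"
proof -
  obtain w where w: "\<And>m. billiard_orbit P k l z m = Some (w m)"
    and fwd: "\<And>m. w m = refl_scale (head P (w (m - 1))) (refr_index k l m) (w (m - 1))"
    and bwd: "\<And>m. w (m - 1) = refl_scale (tail P (w m)) (1 / refr_index k l m) (w m)"
    using strongly_regular_orbit[OF assms(1-4) l] by metis
  obtain j where j: "m' = m + int k * j"
    using assms(7) by (metis add.commute diff_add_cancel mod_eq_dvd_iff dvdE)
  define N where "N = int k * j"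
  have "w (i + N) = w i" for i
  proof (induction i rule: int_induct[where k = m])
    case base
    then show ?case using eq by (simp add: w j N_def)
  next
    case (step1 i)
    have "w (i + 1 + N) = refl_scale (head P (w (i + N))) (refr_index k l (i + 1 + N)) (w (i + N))"
      using fwd[of "i + 1 + N"] by (simp add: algebra_simps)
    then show ?case
      using step1.IH fwd[of "i + 1"] by (simp add: N_def refr_index_periodic)
  next
    case (step2 i)
    have "w (i - 1 + N) = refl_scale (tail P (w (i + N))) (1 / refr_index k l (i + N)) (w (i + N))"
      using bwd[of "i + N"] by (simp add: algebra_simps)
    then show ?case
      using step2.IH bwd[of i] by (simp add: N_def refr_index_periodic)
  qed
  moreover have "0 < N" using assms(6) j by (simp add: N_def)
  moreover have "refr_index k l (i + N) = refr_index k l i" for i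
    by (simp add: N_def refr_index_periodic)
  ultimately show ?thesis
    unfolding periodic_orbit_def by (auto simp: w)
qed

section \<open>Finiteness of bounded orbits\<close>

text \<open>Cramer's rule: pairing with \<open>e2\<close> bounds the coefficient of
  \<open>e1\<close>, and conversely.\<close>

lemma finite_bounded_lattice_points:
  assumes "cross2 e1 e2 \<noteq> 0" "bounded X" "0 < (q::real)"
  shows "finite (X \<inter> {v + (of_int i / q) *\<^sub>R e1 + (of_int j / q) *\<^sub>R e2 | i j :: int. True})"
proof -
  obtain b where b: "\<And>x. x \<in> X \<Longrightarrow> norm x \<le> b"
    using assms(2) bounded_iff by metis
  define K where "K e = 2 * (b + norm v) * norm e * q / \<bar>cross2 e1 e2\<bar>" for e :: "real^2"
  have bd: "\<bar>of_int i\<bar> \<le> K e" if "x \<in> X" "\<bar>cross2 (x - v) e\<bar> = \<bar>of_int i / q * cross2 e1 e2\<bar>"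
    for x e and i :: int
  proof -
    have "norm (x - v) \<le> b + norm v"
      using b[OF that(1)] norm_triangle_ineq4[of x v] by linarith
    then have "2 * norm (x - v) * norm e \<le> 2 * (b + norm v) * norm e"
      by (intro mult_right_mono) auto
    with abs_cross2_le[of "x - v" e] that(2)
    have "\<bar>of_int i / q * cross2 e1 e2\<bar> \<le> 2 * (b + norm v) * norm e"
      by linarith
    then have "\<bar>of_int i\<bar> / q * \<bar>cross2 e1 e2\<bar> \<le> 2 * (b + norm v) * norm e"
      using assms(3) by (simp add: abs_mult)
    then show ?thesis
      using assms(1,3) by (simp add: K_def field_simps)
  qed
  define I where "I e = {- \<lceil>K e\<rceil>..\<lceil>K e\<rceil>}" for e
  have I: "i \<in> I e" if "\<bar>of_int i\<bar> \<le> K e" for i e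
    using that unfolding I_def by (auto simp: abs_le_iff) linarith+
  have "X \<inter> {v + (of_int i / q) *\<^sub>R e1 + (of_int j / q) *\<^sub>R e2 | i j :: int. True}
      \<subseteq> (\<lambda>(i, j). v + (of_int i / q) *\<^sub>R e1 + (of_int j / q) *\<^sub>R e2) ` (I e2 \<times> I e1)"
  proof clarify
    fix i j :: int
    let ?x = "v + (of_int i / q) *\<^sub>R e1 + (of_int j / q) *\<^sub>R e2"
    assume x: "?x \<in> X"
    have "\<bar>cross2 (?x - v) e2\<bar> = \<bar>of_int i / q * cross2 e1 e2\<bar>"
      by (simp add: cross2.add_left cross2.scaleR_left)
    moreover have "\<bar>cross2 (?x - v) e1\<bar> = \<bar>of_int j / q * cross2 e1 e2\<bar>"
      by (simp add: cross2.add_left cross2.scaleR_left cross2_commute[of e2] abs_mult)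
    ultimately have "i \<in> I e2" "j \<in> I e1"
      using bd[OF x] I by blast+
    then show "?x \<in> (\<lambda>(i, j). v + (of_int i / q) *\<^sub>R e1 + (of_int j / q) *\<^sub>R e2) ` (I e2 \<times> I e1)"
      by force
  qed
  then show ?thesis
    by (rule finite_subset) (auto simp: I_def)
qed

lemma ex_common_denominator:
  assumes "finite X" "X \<subseteq> (\<rat> :: real set)"
  obtains q :: nat where "0 < q" "\<And>x. x \<in> X \<Longrightarrow> real q * x \<in> \<int>"
proof -
  have "\<exists>q::nat. 0 < q \<and> (\<forall>x\<in>X. real q * x \<in> \<int>)"
    using assms
  proof (induction rule: finite_induct)
    case (insert x X)
    then obtain q :: nat where q: "0 < q" "\<forall>x\<in>X. real q * x \<in> \<int>" by auto
    obtain m i :: int where "0 < i" "x = of_int m / of_int i"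
      using insert.prems by (auto elim: Rats_cases')
    then obtain n :: nat where mn: "0 < n" "x = of_int m / of_nat n"
      by (auto elim: pos_int_cases)
    have "real (n * q) * y \<in> \<int>" if "y \<in> insert x X" for y
    proof (cases "y = x")
      case True
      then have "real (n * q) * y = of_int (int q * m)"
        using mn by simp
      then show ?thesis by (simp only: Ints_of_int)
    next
      case False
      then have "real q * y \<in> \<int>"
        using that q by blast
      then have "real n * (real q * y) \<in> \<int>"
        by (rule Ints_mult[OF Ints_of_nat])
      then show ?thesis by (simp add: mult.assoc)
    qed
    then show ?case
      using mn(1) q(1) by (intro exI[of _ "n * q"]) auto
  qed auto
  then show thesis using that by blast
qed

text \<open>\<open>a j\<close> is the reciprocal of the product of the first \<open>j mod k\<close>
  indices; total product one makes the recursion hold at the wrap-around too.\<close>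

lemma ex_scale:
  assumes "k \<ge> 1" "\<And>i. i \<in> {1..k} \<Longrightarrow> l i > 0" "(\<Prod>i=1..k. l i) = 1"
    and "\<And>i. i \<in> {1..k} \<Longrightarrow> l i \<in> (\<rat> :: real set)"
  obtains a :: "int \<Rightarrow> real" where "\<And>j. 0 < a j" "\<And>j. a (j + int k) = a j" "\<And>j. a j \<in> \<rat>"
    and "\<And>j. refr_index k l j * a j = a (j - 1)"
proof
  define L where "L n = (\<Prod>i=1..n. l i)" for n :: nat
  define a where "a j = 1 / L (nat (j mod int k))" for j
  have lt: "nat (j mod int k) < k" for j
    using assms(1) by (simp add: nat_less_iff)
  have pos: "0 < L n" if "n \<le> k" for n
    unfolding L_def using assms(2) that by (intro prod_pos) auto
  show "0 < a j" for j
    using pos[of "nat (j mod int k)"] lt[of j] by (simp add: a_def)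
  show "a (j + int k) = a j" for j
    by (simp add: a_def)
  show "a j \<in> \<rat>" for j
    unfolding a_def L_def using assms(4) lt[of j] by (intro Rats_divide Rats_1 Rats_prod) auto
  show "refr_index k l j * a j = a (j - 1)" for j
  proof -
    define r where "r = nat ((j - 1) mod int k)"
    have r: "int r = (j - 1) mod int k" "r < k"
      using assms(1) lt[of "j - 1"] by (auto simp: r_def)
    have "j mod int k = (int r + 1) mod int k"
      unfolding r(1) by (simp add: mod_add_left_eq)
    then have jmod: "L (nat (j mod int k)) = L (Suc r)"
    proof (cases "Suc r = k")
      case True
      then have "int r + 1 = int k" by simp
      then have "(int r + 1) mod int k = 0" by (simp only: mod_self)
      with \<open>j mod int k = _\<close> True assms(3) show ?thesis by (simp add: L_def)
    next
      case False
      then have "(int r + 1) mod int k = int (Suc r)"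
        using r(2) by (simp add: mod_pos_pos_trivial)
      with \<open>j mod int k = _\<close> show ?thesis by (simp only: nat_int)
    qed
    have "L (Suc r) = L r * l (Suc r)"
      by (simp add: L_def)
    moreover have "0 < l (Suc r)" using assms(2) r(2) by simp
    ultimately show ?thesis
      using jmod pos[of r] r(2) by (simp add: a_def refr_index_def r_def[symmetric])
  qed
qed

section \<open>From boundedness to recurrence in a lattice\<close>

theorem theorem2:
  fixes P :: "(real^2) set" and k :: nat and l :: "nat \<Rightarrow> real"
  assumes "convex_polygon P"
    and "k \<ge> 1"
    and "\<And>i. i \<in> {1..k} \<Longrightarrow> l i > 0"
    and "(\<Prod>i=1..k. l i) = 1"
    and "rational_polygon P"
    and "\<And>i. i \<in> {1..k} \<Longrightarrow> l i \<in> \<rat>"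
  shows "\<forall>z. strongly_regular P k l z \<longrightarrow> periodic_orbit P k l z"
proof (intro allI impI)
  fix z assume reg: "strongly_regular P k l z"
  have P: "polytope P" "interior P \<noteq> {}"
    using assms(1) by (auto simp: convex_polygon_def)
  then have P': "compact P" "convex P" "P \<noteq> {}"
    using polytope_imp_compact polytope_imp_convex by auto
  obtain c e1 e2 where e: "e1 \<noteq> e2" "independent {e1, e2}"
    and vert: "\<And>v. v extreme_point_of P \<Longrightarrow> \<exists>i j :: int. v = c + of_int i *\<^sub>R e1 + of_int j *\<^sub>R e2"
    using assms(5) unfolding rational_polygon_def by blast
  have \<kappa>: "cross2 e1 e2 \<noteq> 0"
  proof
    assume "cross2 e1 e2 = 0"
    moreover have "e1 \<noteq> 0"
      using e(2) dependent_zero by blast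
    ultimately obtain t where "e2 = t *\<^sub>R e1"
      using cross2_eq_0_imp_scaleR by metis
    then have "e2 \<in> span ({e1, e2} - {e2})"
      using e(1) by (auto intro: span_scale span_base)
    with e(2) show False
      unfolding dependent_def by blast
  qed
  have lattice: "\<exists>i::int. cross2 (p - q) (r - s) = \<bar>cross2 e1 e2\<bar> * of_int i"
    if V: "p extreme_point_of P" "q extreme_point_of P" "r extreme_point_of P" "s extreme_point_of P" for p q r s
  proof -
    have diff: "\<exists>i j :: int. p - q = of_int i *\<^sub>R e1 + of_int j *\<^sub>R e2"
      if pq: "p extreme_point_of P" "q extreme_point_of P" for p q
    proof -
      obtain i j i' j' :: int where "p = c + of_int i *\<^sub>R e1 + of_int j *\<^sub>R e2"
        "q = c + of_int i' *\<^sub>R e1 + of_int j' *\<^sub>R e2"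
        using vert[OF pq(1)] vert[OF pq(2)] by blast
      then have "p - q = of_int (i - i') *\<^sub>R e1 + of_int (j - j') *\<^sub>R e2"
        by (simp add: algebra_simps)
      then show ?thesis by blast
    qed
    obtain i j i' j' :: int where "p - q = of_int i *\<^sub>R e1 + of_int j *\<^sub>R e2"
      "r - s = of_int i' *\<^sub>R e1 + of_int j' *\<^sub>R e2"
      using diff[OF V(1,2)] diff[OF V(3,4)] by blast
    then have "cross2 (p - q) (r - s) = of_int (i * j' - j * i') * cross2 e1 e2"
      by (simp only:) (simp add: cross2_def algebra_simps)
    \<comment> \<open>The unit has to be positive, so the sign of the determinant moves into the
      integer.\<close>
    also have "\<dots> = \<bar>cross2 e1 e2\<bar> * of_int ((i * j' - j * i') * (if 0 < cross2 e1 e2 then 1 else - 1))"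
      by (simp add: algebra_simps)
    finally show ?thesis by blast
  qed
  obtain a where a: "\<And>j. 0 < a j" "\<And>j. a (j + int k) = a j" "\<And>j. a j \<in> \<rat>"
      "\<And>j. refr_index k l j * a j = a (j - 1)"
    using ex_scale[of k l] assms(2,3,4,6) by metis
  have l_pos: "0 < refr_index k l m" for m
    using a(4)[of m] a(1)[of m] a(1)[of "m - 1"] by (metis zero_less_mult_pos2)
  obtain w where w: "\<And>m. billiard_orbit P k l z m = Some (w m)"
    and out: "\<And>m. w m \<notin> P" and off: "\<And>m. \<not> on_side_line P (w m)"
    and fwd: "\<And>m. w m = refl_scale (head P (w (m - 1))) (refr_index k l m) (w (m - 1))"
    using strongly_regular_orbit[OF P' reg l_pos] by metis
  define A where "A m = head P (w (m - 1))" for m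
  have A: "A m extreme_point_of P" "\<And>p. p \<in> P \<Longrightarrow> cross2 (A m - w (m - 1)) (p - w (m - 1)) \<le> 0" for m
    using head_eq_iff[OF P' out off, of "m - 1" "A m"] by (auto simp: A_def)
  have step: "a n *\<^sub>R w n + a (n - 1) *\<^sub>R w (n - 1) = (a n + a (n - 1)) *\<^sub>R A n" for n
  proof -
    have "a n *\<^sub>R w n = a n *\<^sub>R A n + (refr_index k l n * a n) *\<^sub>R (A n - w (n - 1))"
      unfolding A_def by (subst fwd) (simp add: refl_scale_def scaleR_add_right mult.commute)
    then show ?thesis
      unfolding a(4) by (simp add: algebra_simps)
  qed
  interpret refractive_orbit P k a "\<lambda>n. a n *\<^sub>R w n" A
  proof
    show "0 < k" using assms(2) by simp
    show "0 \<le> cross2 (a (n - 1) *\<^sub>R w (n - 1) - a (n - 1) *\<^sub>R A n) (p - A n)" if "p \<in> P" for p n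
    proof -
      have "cross2 (a (n - 1) *\<^sub>R w (n - 1) - a (n - 1) *\<^sub>R A n) (p - A n)
          = - a (n - 1) * cross2 (A n - w (n - 1)) (p - w (n - 1))"
        by (simp add: cross2_def algebra_simps)
      then show ?thesis
        using A(2)[OF that, of n] a(1)[of "n - 1"] by (simp add: mult_le_0_iff)
    qed
    show "\<not> on_side_line P (a n *\<^sub>R w n /\<^sub>R a n)" for n
      using off[of n] a(1)[of n] by simp
  qed (use P a(1,2) A(1) step in auto)
  \<comment> \<open>The forward half suffices: one repetition there makes the whole orbit
    periodic.\<close>
  have bounded_Y: "bounded ((\<lambda>n. a n *\<^sub>R w n) ` {0..})"
    using bounded_forward[of "\<bar>cross2 e1 e2\<bar>"] \<kappa> lattice by simp
  \<comment> \<open>Seen from \<open>c\<close>, the contact vertices have integer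
    coordinates.\<close>
  define X where "X n = a (int n) *\<^sub>R (w (int n) - c)" for n
  have "bounded (range X)"
  proof -
    obtain b1 where "\<And>m. 0 \<le> m \<Longrightarrow> norm (a m *\<^sub>R w m) \<le> b1"
      using bounded_Y unfolding bounded_iff by auto
    then have b1: "norm (a (int n) *\<^sub>R w (int n)) \<le> b1" for n
      by simp
    have "bounded (range a)"
      by (rule finite_imp_bounded[OF finite_range_a])
    then obtain b2 where b2: "\<And>m. \<bar>a m\<bar> \<le> b2"
      unfolding bounded_iff by auto
    have "norm (X n) \<le> b1 + b2 * norm c" for n
    proof -
      have "X n = a (int n) *\<^sub>R w (int n) - a (int n) *\<^sub>R c"
        by (simp add: X_def scaleR_diff_right)
      then have "norm (X n) \<le> norm (a (int n) *\<^sub>R w (int n)) + norm (a (int n) *\<^sub>R c)"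
        using norm_triangle_ineq4 by metis
      also have "\<dots> \<le> b1 + b2 * norm c"
        unfolding norm_scaleR[of "a (int n)" c] by (intro add_mono b1 mult_right_mono b2 norm_ge_zero)
      finally show ?thesis .
    qed
    then show ?thesis
      unfolding bounded_iff by blast
  qed
  obtain q :: nat where q: "0 < q" "\<And>j. real q * a j \<in> \<int>"
  proof (rule ex_common_denominator[OF finite_range_a])
    show "range a \<subseteq> \<rat>" using a(3) by auto
  qed auto
  \<comment> \<open>As \<open>q\<close> clears the denominators of all weights, each step stays in
    the lattice refined by \<open>1 / q\<close>, up to sign.\<close>
  define lat where "lat v = {v + (of_int i / q) *\<^sub>R e1 + (of_int j / q) *\<^sub>R e2 | i j :: int. True}" for v
  have X_Suc: "\<exists>i j :: int. X (Suc n) = (of_int i / q) *\<^sub>R e1 + (of_int j / q) *\<^sub>R e2 - X n" for n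
  proof -
    let ?b = "a (int (Suc n)) + a (int n)"
    obtain i j :: int where ij: "A (int (Suc n)) = c + of_int i *\<^sub>R e1 + of_int j *\<^sub>R e2"
      using vert[OF A(1)] by blast
    have "real q * ?b \<in> \<int>"
      using q(2)[of "int (Suc n)"] q(2)[of "int n"] by (auto simp: distrib_left)
    then obtain m :: int where "real q * ?b = of_int m"
      by (elim Ints_cases)
    then have b: "?b = of_int m / q"
      using q(1) by (simp add: field_simps)
    have "X (Suc n) + X n = ?b *\<^sub>R (A (int (Suc n)) - c)"
      using step[of "int (Suc n)"] by (simp add: X_def algebra_simps)
    also have "\<dots> = (of_int (m * i) / q) *\<^sub>R e1 + (of_int (m * j) / q) *\<^sub>R e2"
      unfolding b ij by (simp add: scaleR_add_right)
    finally have "X (Suc n) = (of_int (m * i) / q) *\<^sub>R e1 + (of_int (m * j) / q) *\<^sub>R e2 - X n"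
      by (simp add: algebra_simps)
    then show ?thesis by blast
  qed
  \<comment> \<open>Each step reverses the sign, so the orbit alternates between two cosets.\<close>
  have "X n \<in> lat (X 0) \<union> lat (- X 0)" for n
  proof (induction n)
    case 0
    have "X 0 = X 0 + (of_int 0 / q) *\<^sub>R e1 + (of_int 0 / q) *\<^sub>R e2" by simp
    then show ?case unfolding lat_def by blast
  next
    case (Suc n)
    have flip: "X (Suc n) \<in> lat (- v)" if vn: "X n \<in> lat v" for v
    proof -
      obtain i j :: int where "X n = v + (of_int i / q) *\<^sub>R e1 + (of_int j / q) *\<^sub>R e2"
        using vn unfolding lat_def by blast
      moreover obtain i' j' :: int where "X (Suc n) = (of_int i' / q) *\<^sub>R e1 + (of_int j' / q) *\<^sub>R e2 - X n"
        using X_Suc by blast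
      ultimately have "X (Suc n) = - v + (of_int (i' - i) / q) *\<^sub>R e1 + (of_int (j' - j) / q) *\<^sub>R e2"
        by (simp add: algebra_simps diff_divide_distrib)
      then show ?thesis unfolding lat_def by blast
    qed
    then show ?case
      using Suc flip[of "X 0"] flip[of "- X 0"] by auto
  qed
  then have "range X \<subseteq> (range X \<inter> lat (X 0)) \<union> (range X \<inter> lat (- X 0))"
    by blast
  moreover have "finite (range X \<inter> lat v)" for v
    unfolding lat_def using q(1) by (intro finite_bounded_lattice_points \<kappa> \<open>bounded (range X)\<close>) simp
  ultimately have "finite (range X)"
    by (meson finite_Un finite_subset)
  \<comment> \<open>Recording \<open>n mod k\<close> makes the repetition occur at equal phase,
    where the weights agree and can be divided out.\<close>
  then have "finite (range (\<lambda>n. (n mod k, X n)))"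
    by (rule_tac finite_subset[of _ "{..<k} \<times> range X"]) (use assms(2) in auto)
  then have "\<not> inj (\<lambda>n. (n mod k, X n))"
    using finite_imageD infinite_UNIV_nat by blast
  then obtain n n' where n: "n < n'" "n mod k = n' mod k" "X n = X n'"
    unfolding inj_def by (metis linorder_neqE_nat prod.inject)
  have mod: "int n mod int k = int n' mod int k"
    using n(2) by (metis zmod_int)
  then have "a (int n) = a (int n')"
    using a_mod by metis
  then have "w (int n) = w (int n')"
    using n(3) a(1)[of "int n'"] by (simp add: X_def)
  then show "periodic_orbit P k l z"
    using n(1) mod by (intro periodic_orbit_if_recurrent[OF P' reg l_pos, of "int n" "int n'"]) (auto simp: w)
qed

end
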